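(* Let $\mathcal L=(X,\succeq)$ be a finite lattice. Then there is a standard matching market instance $I^*$ such that $\mathcal L$ is order-isomorphic to the lattice of stable matchings $(\mathcal S(I^* ),\succeq)$ of $I^*$. Furthermore, $I^*$ has $O(|X|^4)$ agents, and can be constructed in $O(|X|^6)$ time.
   Context: All sets are finite. A lattice $(X,\succeq)$ is given as input by the set $X$ together with tables of all pairwise joins and meets. A matching market instance $I=(F,W,(\mathcal C_f)_{f\in F},(\mathcal C_w)_{w\in W})$ consists of disjoint finite sets of firms $F$ and workers $W$, with choice functions $\mathcal C_f:2^W\to 2^W$, $\mathcal C_w:2^F\to 2^F$ satisfying $\mathcal C_a(S)\subseteq S$. A choice function $\mathcal C$ is substitutable if $a\in\mathcal C(S)$ implies $a\in\mathcal C(T\cup\{a\})$ for all $T\subseteq S$; it is consistent if $\mathcal C(S)\subseteq T\subseteq S$ implies $\mathcal C(S)=\mathcal C(T)$; path-independent means both. A matching $\mu$ is a set of firm–worker pairs ($\mu(a)$ denotes the partners of agent $a$); it is individually rational if $\mathcal C_a(\mu(a))=\mu(a)$ for every agent $a$; a pair $(f,w)\notin\mu$ is blocking if $f\in\mathcal C_w(\mu(w)\cup\{f\})$ and $w\in\mathcal C_f(\mu(f)\cup\{w\})$; $\mu$ is stable if it is individually rational and has no blocking pair. $\mathcal S(I)$ is the set of stable matchings, ordered by $\mu\succeq\mu'$ iff $\mathcal C_f(\mu(f)\cup\mu'(f))=\mu(f)$ for all $f\in F$; under path-independence this is a lattice. A standard matching market instance is one whose choice functions are all path-independent and which is given as input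 by its agent sets together with an algorithm, encodable in space polynomial in $|F|+|W|$, that computes $\mathcal C_a(T)$ for any agent $a$ and input $T$ in time polynomial in $|F|+|W|$. An order-isomorphism between posets is a bijection $\psi$ with $x\succeq x'\iff\psi(x)\succeq\psi(x')$. *)

theory Defs
  imports
    "HOL-Algebra.Lattice"
    "HOL-Computational_Algebra.Polynomial"
    "HOL-Library.Discrete_Functions"
begin

section \<open>Matching markets\<close>

text \<open>Firms and workers are named by elements of one type. The sets of firms and workers are
  disjoint, so one function \<open>choice\<close> carries both families of choice functions. Its value on an
  argument that is not a set of agents of the opposite side has no meaning.\<close>

record 'v market =
  firms :: "'v set"
  workers :: "'v set"
  choice :: "'v \<Rightarrow> 'v set \<Rightarrow> 'v set"

definition agents :: "'v market \<Rightarrow> 'v set" where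
  "agents I = firms I \<union> workers I"

definition opposite :: "'v market \<Rightarrow> 'v \<Rightarrow> 'v set" where
  "opposite I a = (if a \<in> firms I then workers I else firms I)"

definition matching_market :: "'v market \<Rightarrow> bool" where
  "matching_market I \<longleftrightarrow>
     finite (firms I) \<and> finite (workers I) \<and> firms I \<inter> workers I = {} \<and>
     (\<forall>a\<in>agents I. \<forall>S. S \<subseteq> opposite I a \<longrightarrow> choice I a S \<subseteq> S)"

definition substitutable_on :: "'v set \<Rightarrow> ('v set \<Rightarrow> 'v set) \<Rightarrow> bool" where
  "substitutable_on E C \<longleftrightarrow>
     (\<forall>S T a. S \<subseteq> E \<longrightarrow> T \<subseteq> S \<longrightarrow> a \<in> C S \<longrightarrow> a \<in> C (T \<union> {a}))"

definition consistent_on :: "'v set \<Rightarrow> ('v set \<Rightarrow> 'v set) \<Rightarrow> bool" where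
  "consistent_on E C \<longleftrightarrow>
     (\<forall>S T. S \<subseteq> E \<longrightarrow> C S \<subseteq> T \<longrightarrow> T \<subseteq> S \<longrightarrow> C S = C T)"

definition path_independent_on :: "'v set \<Rightarrow> ('v set \<Rightarrow> 'v set) \<Rightarrow> bool" where
  "path_independent_on E C \<longleftrightarrow> substitutable_on E C \<and> consistent_on E C"

text \<open>A matching is a set of pairs whose first component is a firm and whose second component
  is a worker.\<close>

definition partners :: "('v \<times> 'v) set \<Rightarrow> 'v \<Rightarrow> 'v set" where
  "partners \<mu> a = {b. (a, b) \<in> \<mu> \<or> (b, a) \<in> \<mu>}"

definition individually_rational :: "'v market \<Rightarrow> ('v \<times> 'v) set \<Rightarrow> bool" where
  "individually_rational I \<mu> \<longleftrightarrow> (\<forall>a\<in>agents I. choice I a (partners \<mu> a) = partners \<mu> a)"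

definition blocking_pair :: "'v market \<Rightarrow> ('v \<times> 'v) set \<Rightarrow> 'v \<Rightarrow> 'v \<Rightarrow> bool" where
  "blocking_pair I \<mu> f w \<longleftrightarrow>
     f \<in> firms I \<and> w \<in> workers I \<and> (f, w) \<notin> \<mu> \<and>
     f \<in> choice I w (partners \<mu> w \<union> {f}) \<and> w \<in> choice I f (partners \<mu> f \<union> {w})"

definition stable :: "'v market \<Rightarrow> ('v \<times> 'v) set \<Rightarrow> bool" where
  "stable I \<mu> \<longleftrightarrow>
     \<mu> \<subseteq> firms I \<times> workers I \<and> individually_rational I \<mu> \<and> \<not> (\<exists>f w. blocking_pair I \<mu> f w)"

text \<open>\<open>\<mu> \<sqsubseteq> \<mu>'\<close> says that every firm weakly prefers \<open>\<mu>'\<close>, i.e. \<open>\<mu>' \<succeq> \<mu>\<close>.\<close>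

definition stable_lattice :: "'v market \<Rightarrow> ('v \<times> 'v) set gorder" where
  "stable_lattice I =
     \<lparr> carrier = {\<mu>. stable I \<mu>}, eq = (=),
       le = (\<lambda>\<mu> \<mu>'. \<forall>f\<in>firms I. choice I f (partners \<mu>' f \<union> partners \<mu> f) = partners \<mu>' f) \<rparr>"

definition order_isomorphic :: "'a gorder \<Rightarrow> 'b gorder \<Rightarrow> bool" where
  "order_isomorphic L M \<longleftrightarrow>
     (\<exists>\<psi>. bij_betw \<psi> (carrier L) (carrier M) \<and>
       (\<forall>x\<in>carrier L. \<forall>y\<in>carrier L. x \<sqsubseteq>\<^bsub>L\<^esub> y \<longleftrightarrow> \<psi> x \<sqsubseteq>\<^bsub>M\<^esub> \<psi> y))"


section \<open>Algorithms and running time\<close>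

text \<open>A random access machine with structured control flow and uniform (unit) cost. The state has
  a bank of registers, an indirectly addressed memory, an input tape that is read once from left
  to right and an output tape that is only appended to. Cells hold natural numbers. The arithmetic
  is addition and truncated subtraction only: with multiplication at unit cost, polynomial time on
  such a machine would not be polynomial time on a Turing machine.\<close>

datatype com =
    Skip
  | SetC nat nat
  | Move nat nat
  | LoadM nat nat
  | StoreM nat nat
  | Add nat nat nat
  | Sub nat nat nat
  | Read nat
  | Write nat
  | Seq com com
  | Cond nat com com
  | While nat com

record state =
  reg :: "nat \<Rightarrow> nat"
  mem :: "nat \<Rightarrow> nat"
  inp :: "nat list"
  out :: "nat list"

text \<open>\<open>exec c s t s'\<close>: started in \<open>s\<close>, the program \<open>c\<close> terminates in \<open>s'\<close> after exactly \<open>t\<close> steps.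
  Reading beyond the end of the input yields 0.\<close>

inductive exec :: "com \<Rightarrow> state \<Rightarrow> nat \<Rightarrow> state \<Rightarrow> bool" where
  Skip: "exec Skip s 1 s"
| SetC: "exec (SetC r k) s 1 (s\<lparr>reg := (reg s)(r := k)\<rparr>)"
| Move: "exec (Move r i) s 1 (s\<lparr>reg := (reg s)(r := reg s i)\<rparr>)"
| LoadM: "exec (LoadM r i) s 1 (s\<lparr>reg := (reg s)(r := mem s (reg s i))\<rparr>)"
| StoreM: "exec (StoreM r i) s 1 (s\<lparr>mem := (mem s)(reg s r := reg s i)\<rparr>)"
| Add: "exec (Add r i j) s 1 (s\<lparr>reg := (reg s)(r := reg s i + reg s j)\<rparr>)"
| Sub: "exec (Sub r i j) s 1 (s\<lparr>reg := (reg s)(r := reg s i - reg s j)\<rparr>)"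
| Read_Nil: "inp s = [] \<Longrightarrow> exec (Read r) s 1 (s\<lparr>reg := (reg s)(r := 0)\<rparr>)"
| Read_Cons: "inp s = x # xs \<Longrightarrow> exec (Read r) s 1 (s\<lparr>reg := (reg s)(r := x), inp := xs\<rparr>)"
| Write: "exec (Write r) s 1 (s\<lparr>out := out s @ [reg s r]\<rparr>)"
| Seq: "exec c1 s1 t1 s2 \<Longrightarrow> exec c2 s2 t2 s3 \<Longrightarrow> exec (Seq c1 c2) s1 (t1 + t2) s3"
| Cond_True: "reg s r \<noteq> 0 \<Longrightarrow> exec c1 s t s' \<Longrightarrow> exec (Cond r c1 c2) s (Suc t) s'"
| Cond_False: "reg s r = 0 \<Longrightarrow> exec c2 s t s' \<Longrightarrow> exec (Cond r c1 c2) s (Suc t) s'"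
| While_False: "reg s r = 0 \<Longrightarrow> exec (While r c) s 1 s"
| While_True: "reg s1 r \<noteq> 0 \<Longrightarrow> exec c s1 t1 s2 \<Longrightarrow> exec (While r c) s2 t2 s3 \<Longrightarrow>
    exec (While r c) s1 (Suc (t1 + t2)) s3"

inductive_cases exec_basicE:
  "exec Skip s t s'" "exec (SetC r k) s t s'" "exec (Move r i) s t s'" "exec (LoadM r i) s t s'"
  "exec (StoreM r i) s t s'" "exec (Add r i j) s t s'" "exec (Sub r i j) s t s'"
  "exec (Read r) s t s'" "exec (Write r) s t s'"
inductive_cases exec_SeqE: "exec (Seq c1 c2) s t s'"
inductive_cases exec_CondE: "exec (Cond r c1 c2) s t s'"
inductive_cases exec_WhileE: "exec (While r c) s t s'"

lemma exec_deterministic: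
  "exec c s t s1 \<Longrightarrow> exec c s u s2 \<Longrightarrow> t = u \<and> s1 = s2"
proof (induction arbitrary: u s2 rule: exec.induct)
  case (Seq c1 s1 t1 s2 c2 t2 s3 u s3')
  from Seq.prems obtain t1' s2' t2' where
    "exec c1 s1 t1' s2'" "exec c2 s2' t2' s3'" "u = t1' + t2'"
    by (rule exec_SeqE)
  with Seq.IH(1)[of t1' s2'] Seq.IH(2)[of t2' s3'] show ?case by simp
next
  case (Cond_True s r c1 t s' c2 u s'')
  from Cond_True.prems Cond_True.hyps obtain u' where "exec c1 s u' s''" "u = Suc u'"
    by (auto elim: exec_CondE)
  with Cond_True.IH[of u' s''] show ?case by simp
next
  case (Cond_False s r c2 t s' c1 u s'')
  from Cond_False.prems Cond_False.hyps obtain u' where "exec c2 s u' s''" "u = Suc u'"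
    by (auto elim: exec_CondE)
  with Cond_False.IH[of u' s''] show ?case by simp
next
  case (While_True s1 r c t1 s2 t2 s3 u s3')
  from While_True.prems While_True.hyps obtain t1' s2' t2' where
    "exec c s1 t1' s2'" "exec (While r c) s2' t2' s3'" "u = Suc (t1' + t2')"
    by (auto elim: exec_WhileE)
  with While_True.IH(1)[of t1' s2'] While_True.IH(2)[of t2' s3'] show ?case by simp
next
  case (While_False s r c u s')
  then show ?case by (auto elim: exec_WhileE)
qed (auto elim: exec_basicE)

definition initial_state :: "nat list \<Rightarrow> state" where
  "initial_state xs = \<lparr> reg = (\<lambda>_. 0), mem = (\<lambda>_. 0), inp = xs, out = [] \<rparr>"

definition computes_within :: "com \<Rightarrow> nat list \<Rightarrow> nat list \<Rightarrow> nat \<Rightarrow> bool" where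
  "computes_within c xs ys T \<longleftrightarrow>
     (\<exists>t s. exec c (initial_state xs) t s \<and> t \<le> T \<and> out s = ys)"

text \<open>Programs as words over the natural numbers. This is a prefix code, so a program can be
  recovered from its encoding.\<close>

fun encode_com :: "com \<Rightarrow> nat list" where
  "encode_com Skip = [0]"
| "encode_com (SetC r k) = [1, r, k]"
| "encode_com (Move r i) = [2, r, i]"
| "encode_com (LoadM r i) = [3, r, i]"
| "encode_com (StoreM r i) = [4, r, i]"
| "encode_com (Add r i j) = [5, r, i, j]"
| "encode_com (Sub r i j) = [6, r, i, j]"
| "encode_com (Read r) = [7, r]"
| "encode_com (Write r) = [8, r]"
| "encode_com (Seq c1 c2) = 9 # encode_com c1 @ encode_com c2"
| "encode_com (Cond r c1 c2) = 10 # r # encode_com c1 @ encode_com c2"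
| "encode_com (While r c) = 11 # r # encode_com c"

lemma encode_com_prefix_code:
  "encode_com c @ xs = encode_com d @ ys \<Longrightarrow> c = d \<and> xs = ys"
proof (induction c arbitrary: d xs ys)
  case (Seq c1 c2)
  from Seq.prems show ?case by (cases d) (auto dest!: Seq.IH)
next
  case (Cond r c1 c2)
  from Cond.prems show ?case by (cases d) (auto dest!: Cond.IH)
next
  case (While r c)
  from While.prems show ?case by (cases d) (auto dest!: While.IH)
qed (case_tac d; simp)+

corollary inj_encode_com: "inj encode_com"
  by (rule injI) (use encode_com_prefix_code[where xs = "[]" and ys = "[]"] in auto)

text \<open>The number of bits that are needed to write the numbers of a list in binary.\<close>

definition bit_size :: "nat list \<Rightarrow> nat" where
  "bit_size xs = (\<Sum>k\<leftarrow>xs. Suc (floor_log k))"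


section \<open>Input formats\<close>

definition enumerates :: "'a list \<Rightarrow> 'a set \<Rightarrow> bool" where
  "enumerates xs A \<longleftrightarrow> distinct xs \<and> set xs = A"

text \<open>Relative to an enumeration \<open>xs\<close> of its carrier, a lattice is given by its number of elements
  and the join and meet tables (row by row), with an element written as its position in \<open>xs\<close>.\<close>

definition encode_lattice :: "'a gorder \<Rightarrow> 'a list \<Rightarrow> nat list" where
  "encode_lattice L xs =
     (let position = inv_into {..<length xs} ((!) xs)
      in length xs
         # [position (x \<squnion>\<^bsub>L\<^esub> y). x \<leftarrow> xs, y \<leftarrow> xs]
         @ [position (x \<sqinter>\<^bsub>L\<^esub> y). x \<leftarrow> xs, y \<leftarrow> xs])"

text \<open>A market is given by its lists of firms and of workers and a program for the choice
  functions.\<close>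

definition encode_market :: "nat list \<Rightarrow> nat list \<Rightarrow> com \<Rightarrow> nat list" where
  "encode_market Fs Ws Q = length Fs # Fs @ length Ws # Ws @ encode_com Q"

text \<open>An argument of the program \<open>Q\<close> is an agent together with a list of agents of the opposite
  side, preceded by its length. The polynomial \<open>p\<close> is a parameter: for a single market,
  ``polynomial in the number of agents'' is no restriction, so a statement about all markets of a
  family has to fix \<open>p\<close> for the whole family.\<close>

definition standard_market ::
  "nat poly \<Rightarrow> nat market \<Rightarrow> nat list \<Rightarrow> nat list \<Rightarrow> com \<Rightarrow> bool" where
  "standard_market p I Fs Ws Q \<longleftrightarrow>
     matching_market I \<and>
     (\<forall>a\<in>agents I. path_independent_on (opposite I a) (choice I a)) \<and>
     enumerates Fs (firms I) \<and> enumerates Ws (workers I) \<and>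
     bit_size (encode_market Fs Ws Q) \<le> poly p (card (firms I) + card (workers I)) \<and>
     (\<forall>a\<in>agents I. \<forall>T ts. T \<subseteq> opposite I a \<longrightarrow> enumerates ts T \<longrightarrow>
        (\<exists>ys. enumerates ys (choice I a T) \<and>
          computes_within Q (a # length ts # ts) ys
            (poly p (card (firms I) + card (workers I)))))"

end

theory Submission
  imports Defs
begin

text \<open>
  Let the lattice have \<open>n\<close> elements, and let \<open>G\<close> be the closure operator that maps a set of elements
  to the down-set of its join. Its fixed points are the principal down-sets, which ordered by
  inclusion form a copy of the lattice. The market makes stability a fixed-point equation for \<open>G\<close>.
  There are two firms, \<open>2 * n\<close> and \<open>2 * n + 1\<close>, and for every element \<open>i\<close> two workers, \<open>i\<close> and \<open>n + i\<close>,
  each of whom accepts a single firm. Worker \<open>i\<close> prefers firm \<open>2 * n\<close>, worker \<open>n + i\<close> prefers firm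
  \<open>2 * n + 1\<close>. Firm \<open>2 * n\<close> wants every worker \<open>n + i\<close>, and wants worker \<open>i\<close> unless \<open>i \<in> G V\<close>, where \<open>V\<close>
  is the set of all \<open>k\<close> such that it has worker \<open>n + k\<close>; for firm \<open>2 * n + 1\<close> the roles of \<open>i\<close> and
  \<open>n + i\<close> are exchanged. If \<open>U\<close> is the set of all \<open>k\<close> such that firm \<open>2 * n + 1\<close> has worker \<open>k\<close>, then
  stability says \<open>U = G V\<close> and \<open>V = G U\<close>, i.e. \<open>U = V = G V\<close> as \<open>G\<close> is idempotent. So \<open>2 * n + 2\<close>
  agents suffice. The program for the choice functions carries the join table in its text.
\<close>

section \<open>Markets from closure operators\<close>

definition slice :: "nat \<Rightarrow> nat \<Rightarrow> nat set \<Rightarrow> nat set" where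
  "slice n d S = {k. k < n \<and> d + k \<in> S}"

text \<open>A firm always keeps its input workers \<open>i + k\<close>; these make it reject the output workers \<open>j + k\<close>
  with \<open>k \<in> G (slice n i S)\<close>.\<close>

definition firm_choice :: "nat \<Rightarrow> (nat set \<Rightarrow> nat set) \<Rightarrow> nat \<Rightarrow> nat \<Rightarrow> nat set \<Rightarrow> nat set" where
  "firm_choice n G i j S = S - (+) j ` G (slice n i S)"

text \<open>Unit demand with the strict preference list \<open>x\<close>, \<open>y\<close>.\<close>

definition worker_choice :: "nat \<Rightarrow> nat \<Rightarrow> nat set \<Rightarrow> nat set" where
  "worker_choice x y S = S \<inter> (if x \<in> S then {x} else {y})"

definition closure_market :: "nat \<Rightarrow> (nat set \<Rightarrow> nat set) \<Rightarrow> nat market" where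
  "closure_market n G =
     \<lparr> firms = {2 * n, 2 * n + 1}, workers = {..<2 * n},
       choice = (\<lambda>a.
         if a < n then worker_choice (2 * n) (2 * n + 1)
         else if a < 2 * n then worker_choice (2 * n + 1) (2 * n)
         else if a = 2 * n then firm_choice n G n 0
         else firm_choice n G 0 n) \<rparr>"

text \<open>The candidate with \<open>U = V = S\<close>. The workers \<open>i\<close> and
  \<open>n + i\<close> both get their second choice if \<open>i\<close> lies in \<open>S\<close> and
  both their first choice otherwise, so a larger \<open>S\<close> is better for the firms.\<close>

definition closure_matching :: "nat \<Rightarrow> nat set \<Rightarrow> (nat \<times> nat) set" where
  "closure_matching n S =
     {2 * n} \<times> ((+) n ` S \<union> ({..<n} - S)) \<union>
     {2 * n + 1} \<times> (S \<union> (+) n ` ({..<n} - S))"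

lemma path_independent_worker_choice: "path_independent_on E (worker_choice x y)"
  unfolding path_independent_on_def
proof
  show "substitutable_on E (worker_choice x y)"
    unfolding substitutable_on_def
  proof (intro allI impI)
    fix S T a assume "T \<subseteq> S" and "a \<in> worker_choice x y S"
    then show "a \<in> worker_choice x y (T \<union> {a})"
      by (cases "x \<in> S"; cases "x \<in> T") (auto simp: worker_choice_def)
  qed
  show "consistent_on E (worker_choice x y)"
    unfolding consistent_on_def
  proof (intro allI impI)
    fix S T assume "worker_choice x y S \<subseteq> T" and "T \<subseteq> S"
    then show "worker_choice x y S = worker_choice x y T"
      by (cases "x \<in> S"; cases "x \<in> T") (auto simp: worker_choice_def)
  qed
qed

text \<open>\<open>mono\<close> will make the choice of a firm substitutable, \<open>sub\<close>
  keeps rejected outputs apart from inputs, and \<open>idem\<close> merges \<open>U = G V\<close>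
  and \<open>V = G U\<close> into one equation.\<close>

locale closure_op =
  fixes n :: nat and G :: "nat set \<Rightarrow> nat set"
  assumes sub: "G S \<subseteq> {..<n}"
    and mono: "S \<subseteq> T \<Longrightarrow> G S \<subseteq> G T"
    and idem: "G (G S) = G S"
begin

text \<open>A smaller offer has fewer inputs, hence by monotonicity fewer rejections: this is
  substitutability. Inputs are never rejected, so removing rejected workers leaves the slice
  unchanged: this is consistency.\<close>

lemma path_independent_firm_choice:
  assumes "i = n \<and> j = 0 \<or> i = 0 \<and> j = n"
  shows "path_independent_on E (firm_choice n G i j)"
  unfolding path_independent_on_def
proof
  show "substitutable_on E (firm_choice n G i j)"
    unfolding substitutable_on_def
  proof (intro allI impI)
    fix S T a assume "T \<subseteq> S" and a: "a \<in> firm_choice n G i j S"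
    \<comment> \<open>The chosen \<open>a\<close> lies in \<open>S\<close>, so adding it to
      \<open>T\<close> does not leave \<open>S\<close>.\<close>
    then have "slice n i (T \<union> {a}) \<subseteq> slice n i S" by (auto simp: slice_def firm_choice_def)
    then have "G (slice n i (T \<union> {a})) \<subseteq> G (slice n i S)" by (rule mono)
    with a show "a \<in> firm_choice n G i j (T \<union> {a})" by (auto simp: firm_choice_def)
  qed
  show "consistent_on E (firm_choice n G i j)"
    unfolding consistent_on_def
  proof (intro allI impI)
    fix S T assume c: "firm_choice n G i j S \<subseteq> T" and "T \<subseteq> S"
    have "slice n i S \<subseteq> slice n i T"
    proof
      fix k assume k: "k \<in> slice n i S"
      \<comment> \<open>All rejected workers lie in the output block, which is disjoint from the
        input block.\<close>
      then have "i + k \<in> firm_choice n G i j S"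
        using assms sub[of "slice n i S"] by (auto simp: firm_choice_def slice_def)
      with c k show "k \<in> slice n i T" by (auto simp: slice_def)
    qed
    with \<open>T \<subseteq> S\<close> have "slice n i S = slice n i T" by (auto simp: slice_def)
    with c \<open>T \<subseteq> S\<close> show "firm_choice n G i j S = firm_choice n G i j T"
      by (auto simp: firm_choice_def)
  qed
qed

section \<open>Stable matchings of the closure market\<close>

abbreviation "I \<equiv> closure_market n G"

lemma agents_eq: "agents I = {..<2 * n + 2}"
  by (auto simp: agents_def closure_market_def)

lemma choice_simps:
  "i < n \<Longrightarrow> choice I i = worker_choice (2 * n) (2 * n + 1)"
  "i < n \<Longrightarrow> choice I (n + i) = worker_choice (2 * n + 1) (2 * n)"
  "choice I (2 * n) = firm_choice n G n 0"
  "choice I (Suc (2 * n)) = firm_choice n G 0 n"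
  by (auto simp: closure_market_def)

lemma market_simps: "firms I = {2 * n, 2 * n + 1}" "workers I = {..<2 * n}"
  by (simp_all add: closure_market_def)

lemma matching_market: "matching_market I"
  unfolding matching_market_def
  by (auto simp: closure_market_def worker_choice_def firm_choice_def)

lemma path_independent: "path_independent_on E (choice I a)"
  using path_independent_worker_choice path_independent_firm_choice
  by (auto simp: closure_market_def)

lemma partners_matching:
  assumes "\<mu> \<subseteq> {2 * n, 2 * n + 1} \<times> {..<2 * n}"
  shows "i < 2 * n \<Longrightarrow> partners \<mu> i = {f \<in> {2 * n, 2 * n + 1}. (f, i) \<in> \<mu>}"
    and "f \<ge> 2 * n \<Longrightarrow> partners \<mu> f = {w \<in> {..<2 * n}. (f, w) \<in> \<mu>}"
  using assms by (auto simp: partners_def)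

text \<open>Splits the workers into their two blocks, so that all later conditions can be compared
  index by index.\<close>

lemma less_double: "(\<forall>w<2 * n. P w) \<longleftrightarrow> (\<forall>i<n. P i \<and> P (n + i))" for P :: "nat \<Rightarrow> bool"
proof
  assume *: "\<forall>i<n. P i \<and> P (n + i)"
  show "\<forall>w<2 * n. P w"
  proof (intro allI impI)
    fix w :: nat assume "w < 2 * n"
    then show "P w" using * [rule_format, of w] * [rule_format, of "w - n"] by (cases "w < n") auto
  qed
qed auto

lemma shift_in_image: "n + i \<in> (+) n ` S \<longleftrightarrow> i \<in> S" for i :: nat
  by auto

lemma worker_choice_fixed_iff:
  "P \<subseteq> {x, y} \<Longrightarrow> x \<noteq> y \<Longrightarrow> worker_choice x y P = P \<longleftrightarrow> \<not> (x \<in> P \<and> y \<in> P)"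
  by (auto simp: worker_choice_def)

lemma worker_choice_insert:
  "x \<noteq> y \<Longrightarrow> x \<in> worker_choice x y (insert x P)"
  "x \<noteq> y \<Longrightarrow> y \<in> worker_choice x y (insert y P) \<longleftrightarrow> x \<notin> P"
  by (auto simp: worker_choice_def)

lemma firm_choice_fixed_iff:
  "firm_choice n G i j P = P \<longleftrightarrow> (\<forall>k<n. k \<in> G (slice n i P) \<longrightarrow> j + k \<notin> P)"
  using sub by (fastforce simp: firm_choice_def)

lemma not_in_shift: "i < n \<Longrightarrow> i \<notin> (+) n ` S" "n + i \<notin> G S"
  using sub[of S] by auto

text \<open>Each equivalence is split in two. Individual rationality gives one half: no firm keeps a
  rejected output and no worker has two firms. Absence of blocking pairs gives the other: nothing
  acceptable to both sides is left out.\<close>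

lemma stable_iff:
  assumes \<mu>: "\<mu> \<subseteq> {2 * n, 2 * n + 1} \<times> {..<2 * n}"
  defines "V \<equiv> {k. k < n \<and> (2 * n, n + k) \<in> \<mu>}" and "U \<equiv> {k. k < n \<and> (2 * n + 1, k) \<in> \<mu>}"
  shows "stable I \<mu> \<longleftrightarrow>
    (\<forall>i<n. ((2 * n, i) \<in> \<mu> \<longleftrightarrow> i \<notin> G V) \<and> ((2 * n + 1, i) \<in> \<mu> \<longleftrightarrow> (2 * n, i) \<notin> \<mu>) \<and>
           ((2 * n + 1, n + i) \<in> \<mu> \<longleftrightarrow> i \<notin> G U) \<and>
           ((2 * n, n + i) \<in> \<mu> \<longleftrightarrow> (2 * n + 1, n + i) \<notin> \<mu>))"
proof -
  note P = partners_matching[OF \<mu>]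
  have slices: "slice n n (partners \<mu> (2 * n)) = V" "slice n 0 (partners \<mu> (Suc (2 * n))) = U"
    by (auto simp: P slice_def V_def U_def)
  \<comment> \<open>Offering an output worker leaves the inputs alone, so \<open>G\<close> is still
    evaluated at \<open>V\<close> or \<open>U\<close> when a blocking pair is tested.\<close>
  have slice_insert: "i < n \<Longrightarrow> slice n n (insert i S) = slice n n S"
     "slice n 0 (insert (n + i) S) = slice n 0 S" for i S
    by (auto simp: slice_def)
  have worker: "partners \<mu> w \<subseteq> {2 * n, 2 * n + 1}" "f \<in> {2 * n, 2 * n + 1} \<Longrightarrow> f \<in> partners \<mu> w \<longleftrightarrow> (f, w) \<in> \<mu>"
    if "w < 2 * n" for f w
    using P(1)[OF that] by auto
  have firm: "w < 2 * n \<Longrightarrow> w \<in> partners \<mu> (2 * n) \<longleftrightarrow> (2 * n, w) \<in> \<mu>"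
    "w < 2 * n \<Longrightarrow> w \<in> partners \<mu> (Suc (2 * n)) \<longleftrightarrow> (2 * n + 1, w) \<in> \<mu>" for w
    using P(2) by auto
  have ir_worker: "choice I i (partners \<mu> i) = partners \<mu> i \<longleftrightarrow> \<not> ((2 * n, i) \<in> \<mu> \<and> (2 * n + 1, i) \<in> \<mu>)"
    "choice I (n + i) (partners \<mu> (n + i)) = partners \<mu> (n + i) \<longleftrightarrow>
      \<not> ((2 * n, n + i) \<in> \<mu> \<and> (2 * n + 1, n + i) \<in> \<mu>)"
    if "i < n" for i
    using that worker[of i] worker[of "n + i"] worker_choice_fixed_iff[of _ "2 * n" "2 * n + 1"]
      worker_choice_fixed_iff[of _ "2 * n + 1" "2 * n"]
    by (simp_all add: choice_simps insert_commute conj_commute)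
  have ir_firm: "choice I (2 * n) (partners \<mu> (2 * n)) = partners \<mu> (2 * n) \<longleftrightarrow>
      (\<forall>i<n. i \<in> G V \<longrightarrow> (2 * n, i) \<notin> \<mu>)"
    "choice I (Suc (2 * n)) (partners \<mu> (Suc (2 * n))) = partners \<mu> (Suc (2 * n)) \<longleftrightarrow>
      (\<forall>i<n. i \<in> G U \<longrightarrow> (2 * n + 1, n + i) \<notin> \<mu>)"
    by (auto simp: choice_simps firm_choice_fixed_iff slices firm)
  have ir: "individually_rational I \<mu> \<longleftrightarrow>
      (\<forall>i<n. \<not> ((2 * n, i) \<in> \<mu> \<and> (2 * n + 1, i) \<in> \<mu>) \<and>
        \<not> ((2 * n, n + i) \<in> \<mu> \<and> (2 * n + 1, n + i) \<in> \<mu>) \<and>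
        (i \<in> G V \<longrightarrow> (2 * n, i) \<notin> \<mu>) \<and> (i \<in> G U \<longrightarrow> (2 * n + 1, n + i) \<notin> \<mu>))"
  proof -
    have "individually_rational I \<mu> \<longleftrightarrow>
        (\<forall>w<2 * n. choice I w (partners \<mu> w) = partners \<mu> w) \<and>
        choice I (2 * n) (partners \<mu> (2 * n)) = partners \<mu> (2 * n) \<and>
        choice I (Suc (2 * n)) (partners \<mu> (Suc (2 * n))) = partners \<mu> (Suc (2 * n))"
      by (auto simp: individually_rational_def agents_eq less_Suc_eq)
    also have "(\<forall>w<2 * n. choice I w (partners \<mu> w) = partners \<mu> w) \<longleftrightarrow>
        (\<forall>i<n. \<not> ((2 * n, i) \<in> \<mu> \<and> (2 * n + 1, i) \<in> \<mu>) \<and>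
          \<not> ((2 * n, n + i) \<in> \<mu> \<and> (2 * n + 1, n + i) \<in> \<mu>))"
      unfolding less_double using ir_worker by blast
    finally show ?thesis unfolding ir_firm by blast
  qed
  \<comment> \<open>A worker always accepts the first choice, and the second one unless already
    matched to the first.\<close>
  have wc: "2 * n \<in> choice I i (partners \<mu> i \<union> {2 * n})"
    "Suc (2 * n) \<in> choice I i (partners \<mu> i \<union> {Suc (2 * n)}) \<longleftrightarrow> (2 * n, i) \<notin> \<mu>"
    "Suc (2 * n) \<in> choice I (n + i) (partners \<mu> (n + i) \<union> {Suc (2 * n)})"
    "2 * n \<in> choice I (n + i) (partners \<mu> (n + i) \<union> {2 * n}) \<longleftrightarrow> (2 * n + 1, n + i) \<notin> \<mu>"
    if "i < n" for i
    using that worker(2)[of i "2 * n"] worker(2)[of "n + i" "2 * n + 1"]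
    by (simp_all add: choice_simps worker_choice_insert)
  have fc: "i \<in> choice I (2 * n) (partners \<mu> (2 * n) \<union> {i}) \<longleftrightarrow> i \<notin> G V"
    "n + i \<in> choice I (2 * n) (partners \<mu> (2 * n) \<union> {n + i})"
    "i \<in> choice I (Suc (2 * n)) (partners \<mu> (Suc (2 * n)) \<union> {i})"
    "n + i \<in> choice I (Suc (2 * n)) (partners \<mu> (Suc (2 * n)) \<union> {n + i}) \<longleftrightarrow> i \<notin> G U"
    if "i < n" for i
    subgoal using that by (simp add: choice_simps firm_choice_def slice_insert slices)
    subgoal using not_in_shift(2) by (simp add: choice_simps firm_choice_def)
    subgoal using not_in_shift(1)[OF that] by (simp add: choice_simps firm_choice_def del: image_iff)
    subgoal by (simp add: choice_simps firm_choice_def slice_insert slices shift_in_image del: image_iff)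
    done
  have block: "blocking_pair I \<mu> (2 * n) i \<longleftrightarrow> (2 * n, i) \<notin> \<mu> \<and> i \<notin> G V"
    "blocking_pair I \<mu> (2 * n) (n + i) \<longleftrightarrow> (2 * n, n + i) \<notin> \<mu> \<and> (2 * n + 1, n + i) \<notin> \<mu>"
    "blocking_pair I \<mu> (Suc (2 * n)) i \<longleftrightarrow> (2 * n + 1, i) \<notin> \<mu> \<and> (2 * n, i) \<notin> \<mu>"
    "blocking_pair I \<mu> (Suc (2 * n)) (n + i) \<longleftrightarrow> (2 * n + 1, n + i) \<notin> \<mu> \<and> i \<notin> G U"
    if "i < n" for i
    using wc[OF that] fc[OF that] that
    unfolding blocking_pair_def market_simps by auto
  have "(\<exists>f w. blocking_pair I \<mu> f w) \<longleftrightarrow>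
    \<not> (\<forall>w<2 * n. \<not> blocking_pair I \<mu> (2 * n) w \<and> \<not> blocking_pair I \<mu> (Suc (2 * n)) w)"
  proof -
    have "f \<in> {2 * n, 2 * n + 1} \<and> w < 2 * n" if "blocking_pair I \<mu> f w" for f w
      using that unfolding blocking_pair_def market_simps by blast
    then show ?thesis by auto
  qed
  also have "\<dots> \<longleftrightarrow> \<not> (\<forall>i<n. ((2 * n, i) \<in> \<mu> \<or> i \<in> G V) \<and> ((2 * n + 1, i) \<in> \<mu> \<or> (2 * n, i) \<in> \<mu>) \<and>
      ((2 * n, n + i) \<in> \<mu> \<or> (2 * n + 1, n + i) \<in> \<mu>) \<and> ((2 * n + 1, n + i) \<in> \<mu> \<or> i \<in> G U))"
    unfolding less_double using block by blast
  finally have "stable I \<mu> \<longleftrightarrow> individually_rational I \<mu> \<and>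
      (\<forall>i<n. ((2 * n, i) \<in> \<mu> \<or> i \<in> G V) \<and> ((2 * n + 1, i) \<in> \<mu> \<or> (2 * n, i) \<in> \<mu>) \<and>
      ((2 * n, n + i) \<in> \<mu> \<or> (2 * n + 1, n + i) \<in> \<mu>) \<and> ((2 * n + 1, n + i) \<in> \<mu> \<or> i \<in> G U))"
    using \<mu> unfolding stable_def market_simps by blast
  then show ?thesis unfolding ir by blast
qed

lemma matching_eqI:
  assumes "\<mu> \<subseteq> {2 * n, 2 * n + 1} \<times> {..<2 * n}" "\<nu> \<subseteq> {2 * n, 2 * n + 1} \<times> {..<2 * n}"
    and "\<And>f i. f \<in> {2 * n, 2 * n + 1} \<Longrightarrow> i < n \<Longrightarrow>
      ((f, i) \<in> \<mu> \<longleftrightarrow> (f, i) \<in> \<nu>) \<and> ((f, n + i) \<in> \<mu> \<longleftrightarrow> (f, n + i) \<in> \<nu>)"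
  shows "\<mu> = \<nu>"
proof -
  have "\<forall>w<2 * n. (f, w) \<in> \<mu> \<longleftrightarrow> (f, w) \<in> \<nu>" if "f \<in> {2 * n, 2 * n + 1}" for f
    unfolding less_double using assms(3) that by blast
  with assms(1,2) show ?thesis by blast
qed

lemma closure_matching_subset:
  "S \<subseteq> {..<n} \<Longrightarrow> closure_matching n S \<subseteq> {2 * n, 2 * n + 1} \<times> {..<2 * n}"
  by (auto simp: closure_matching_def)

lemma in_closure_matching:
  assumes "i < n"
  shows "(2 * n, i) \<in> closure_matching n S \<longleftrightarrow> i \<notin> S"
    "(2 * n, n + i) \<in> closure_matching n S \<longleftrightarrow> i \<in> S"
    "(2 * n + 1, i) \<in> closure_matching n S \<longleftrightarrow> i \<in> S"
    "S \<subseteq> {..<n} \<Longrightarrow> (2 * n + 1, n + i) \<in> closure_matching n S \<longleftrightarrow> i \<notin> S"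
  using assms by (auto simp: closure_matching_def)

text \<open>Here \<open>V\<close> and \<open>U\<close> are both \<open>S\<close>, and
  \<open>G S = S\<close> turns the criterion into the description of the matching.\<close>

lemma stable_closure_matching:
  assumes "S \<subseteq> {..<n}" "G S = S"
  shows "stable I (closure_matching n S)"
proof -
  have "{k. k < n \<and> (2 * n, n + k) \<in> closure_matching n S} = S"
    "{k. k < n \<and> (2 * n + 1, k) \<in> closure_matching n S} = S"
    using assms(1) in_closure_matching by auto
  then show ?thesis
    using assms stable_iff[OF closure_matching_subset[OF assms(1)]] in_closure_matching by simp
qed

lemma stable_imp_closure_matching:
  assumes "stable I \<mu>"
  obtains S where "S \<subseteq> {..<n}" "G S = S" "\<mu> = closure_matching n S"
proof -
  have \<mu>: "\<mu> \<subseteq> {2 * n, 2 * n + 1} \<times> {..<2 * n}"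
    using assms by (auto simp: stable_def closure_market_def)
  define V U where "V = {k. k < n \<and> (2 * n, n + k) \<in> \<mu>}" and "U = {k. k < n \<and> (2 * n + 1, k) \<in> \<mu>}"
  note st = assms[unfolded stable_iff[OF \<mu>], folded V_def U_def]
  have "U = G V" "V = G U" using st sub[of U] sub[of V] by (auto simp: U_def V_def)
  \<comment> \<open>\<open>U = G V = G (G U) = G U = V\<close>.\<close>
  then have "U = V" by (metis idem)
  then have V: "V \<subseteq> {..<n}" "G V = V" using \<open>U = G V\<close> by (auto simp: V_def)
  moreover have "\<mu> = closure_matching n V"
    using \<mu> closure_matching_subset[OF V(1)]
  proof (rule matching_eqI)
    fix f i assume "f \<in> {2 * n, 2 * n + 1}" "i < n"
    then show "((f, i) \<in> \<mu> \<longleftrightarrow> (f, i) \<in> closure_matching n V) \<and>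
        ((f, n + i) \<in> \<mu> \<longleftrightarrow> (f, n + i) \<in> closure_matching n V)"
      using st in_closure_matching[of i V] V \<open>U = V\<close> by auto
  qed
  ultimately show thesis using that by blast
qed

text \<open>Firm \<open>2 * n\<close> keeps the inputs of both matchings, so choosing the second one
  from the union forces \<open>S \<subseteq> S'\<close>. Conversely the union then has exactly the
  inputs \<open>S'\<close>, and \<open>G S' = S'\<close> removes exactly the outputs that the second
  matching lacks.\<close>

lemma le_closure_matching:
  assumes S: "S \<subseteq> {..<n}" "G S = S" and S': "S' \<subseteq> {..<n}" "G S' = S'"
  shows "closure_matching n S \<sqsubseteq>\<^bsub>stable_lattice I\<^esub> closure_matching n S' \<longleftrightarrow> S \<subseteq> S'"
proof -
  let ?P = "\<lambda>S. partners (closure_matching n S)"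
  have P: "?P S (2 * n) = (+) n ` S \<union> ({..<n} - S)"
    "?P S (Suc (2 * n)) = S \<union> (+) n ` ({..<n} - S)" if "S \<subseteq> {..<n}" for S
    using that by (auto simp: partners_def closure_matching_def)
  have sl: "slice n n (?P S' (2 * n) \<union> ?P S (2 * n)) = S \<union> S'"
    "slice n 0 (?P S' (Suc (2 * n)) \<union> ?P S (Suc (2 * n))) = S \<union> S'"
    using S S' by (auto simp: P slice_def)
  have "closure_matching n S \<sqsubseteq>\<^bsub>stable_lattice I\<^esub> closure_matching n S' \<longleftrightarrow>
    firm_choice n G n 0 (?P S' (2 * n) \<union> ?P S (2 * n)) = ?P S' (2 * n) \<and>
    firm_choice n G 0 n (?P S' (Suc (2 * n)) \<union> ?P S (Suc (2 * n))) = ?P S' (Suc (2 * n))"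
    by (simp add: stable_lattice_def closure_market_def)
  also have "\<dots> \<longleftrightarrow> S \<subseteq> S'"
  proof
    assume "firm_choice n G n 0 (?P S' (2 * n) \<union> ?P S (2 * n)) = ?P S' (2 * n) \<and>
      firm_choice n G 0 n (?P S' (Suc (2 * n)) \<union> ?P S (Suc (2 * n))) = ?P S' (Suc (2 * n))"
    then have *: "firm_choice n G n 0 (?P S' (2 * n) \<union> ?P S (2 * n)) = ?P S' (2 * n)" ..
    show "S \<subseteq> S'"
    proof
      fix i assume "i \<in> S"
      then have "n + i \<in> firm_choice n G n 0 (?P S' (2 * n) \<union> ?P S (2 * n))"
        using sub by (fastforce simp: firm_choice_def P S)
      then have "n + i \<in> ?P S' (2 * n)" unfolding * .
      then show "i \<in> S'" by (auto simp: P S')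
    qed
  next
    assume "S \<subseteq> S'"
    then have "S \<union> S' = S'" by auto
    then show "firm_choice n G n 0 (?P S' (2 * n) \<union> ?P S (2 * n)) = ?P S' (2 * n) \<and>
      firm_choice n G 0 n (?P S' (Suc (2 * n)) \<union> ?P S (Suc (2 * n))) = ?P S' (Suc (2 * n))"
      unfolding firm_choice_def sl using \<open>S \<subseteq> S'\<close> S S' by (auto simp: P)
  qed
  finally show ?thesis .
qed

end


section \<open>Total correctness with time bounds\<close>

text \<open>The time is an upper bound, so that branches of different cost can share it.\<close>

definition runs :: "com \<Rightarrow> state \<Rightarrow> nat \<Rightarrow> (state \<Rightarrow> bool) \<Rightarrow> bool" where
  "runs c s T P \<longleftrightarrow> (\<exists>t s'. exec c s t s' \<and> t \<le> T \<and> P s')"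

lemma runs_mono:
  "runs c s T P \<Longrightarrow> T \<le> T' \<Longrightarrow> (\<And>s'. P s' \<Longrightarrow> P' s') \<Longrightarrow> runs c s T' P'"
  unfolding runs_def by (meson le_trans)

lemma runs_Seq:
  "runs c s T P \<Longrightarrow> (\<And>s'. P s' \<Longrightarrow> runs d s' U R) \<Longrightarrow> runs (Seq c d) s (T + U) R"
  unfolding runs_def by (meson add_mono exec.Seq)

lemma runs_Cond:
  assumes "reg s r \<noteq> 0 \<Longrightarrow> runs c s T P" and "reg s r = 0 \<Longrightarrow> runs d s T P"
  shows "runs (Cond r c d) s (Suc T) P"
proof (cases "reg s r = 0")
  case True
  with assms(2) obtain t s' where "exec d s t s'" "t \<le> T" "P s'" unfolding runs_def by blast
  with True show ?thesis unfolding runs_def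
    by (intro exI[of _ "Suc t"] exI[of _ s']) (auto intro: exec.Cond_False)
next
  case False
  with assms(1) obtain t s' where "exec c s t s'" "t \<le> T" "P s'" unfolding runs_def by blast
  with False show ?thesis unfolding runs_def
    by (intro exI[of _ "Suc t"] exI[of _ s']) (auto intro: exec.Cond_True)
qed

text \<open>The index of the invariant is the number of remaining iterations, so it serves as the
  variant too. Each iteration pays one step for its test, and the final failing test pays the last
  one.\<close>

lemma runs_While:
  assumes "\<And>k s. Inv (Suc k) s \<Longrightarrow> reg s r \<noteq> 0 \<and> runs c s T (Inv k)"
    and "\<And>s. Inv 0 s \<Longrightarrow> reg s r = 0"
    and "Inv k s"
  shows "runs (While r c) s (k * Suc T + 1) (Inv 0)"
  using assms(3)
proof (induction k arbitrary: s)
  case 0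
  then show ?case unfolding runs_def
    using exec.While_False[OF assms(2)] by (intro exI[of _ 1] exI[of _ s]) auto
next
  case (Suc k)
  then obtain t s' where s': "reg s r \<noteq> 0" "exec c s t s'" "t \<le> T" "Inv k s'"
    using assms(1) unfolding runs_def by blast
  with Suc.IH obtain u s'' where "exec (While r c) s' u s''" "u \<le> k * Suc T + 1" "Inv 0 s''"
    unfolding runs_def by blast
  with s' show ?case unfolding runs_def
    by (intro exI[of _ "Suc (t + u)"] exI[of _ s'']) (auto intro: exec.While_True)
qed

section \<open>Loop-free programs by symbolic execution\<close>

fun loop_free :: "com \<Rightarrow> bool" where
  "loop_free (Seq c d) \<longleftrightarrow> loop_free c \<and> loop_free d"
| "loop_free (Cond r c d) \<longleftrightarrow> loop_free c \<and> loop_free d"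
| "loop_free (While r c) \<longleftrightarrow> False"
| "loop_free _ \<longleftrightarrow> True"

text \<open>A total function, so that the simplifier can execute straight-line code. The value on
  \<open>While\<close> is a dummy, excluded by \<open>loop_free\<close>; the same holds for
  \<open>cost\<close>.\<close>

fun run :: "com \<Rightarrow> state \<Rightarrow> state" where
  "run (SetC r k) s = s\<lparr>reg := (reg s)(r := k)\<rparr>"
| "run (Move r i) s = s\<lparr>reg := (reg s)(r := reg s i)\<rparr>"
| "run (LoadM r i) s = s\<lparr>reg := (reg s)(r := mem s (reg s i))\<rparr>"
| "run (StoreM r i) s = s\<lparr>mem := (mem s)(reg s r := reg s i)\<rparr>"
| "run (Add r i j) s = s\<lparr>reg := (reg s)(r := reg s i + reg s j)\<rparr>"
| "run (Sub r i j) s = s\<lparr>reg := (reg s)(r := reg s i - reg s j)\<rparr>"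
| "run (Read r) s = (case inp s of
     [] \<Rightarrow> s\<lparr>reg := (reg s)(r := 0)\<rparr>
   | x # xs \<Rightarrow> s\<lparr>reg := (reg s)(r := x), inp := xs\<rparr>)"
| "run (Write r) s = s\<lparr>out := out s @ [reg s r]\<rparr>"
| "run (Seq c d) s = run d (run c s)"
| "run (Cond r c d) s = (if reg s r \<noteq> 0 then run c s else run d s)"
| "run _ s = s"

fun cost :: "com \<Rightarrow> nat" where
  "cost (Seq c d) = cost c + cost d"
| "cost (Cond r c d) = Suc (max (cost c) (cost d))"
| "cost _ = 1"

lemma runs_loop_free:
  assumes "loop_free c" and "P (run c s)" and "cost c \<le> T"
  shows "runs c s T P"
proof -
  have "\<exists>t. exec c s t (run c s) \<and> t \<le> cost c" using assms(1)
  proof (induction c arbitrary: s)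
    case (Read r)
    show ?case by (cases "inp s") (use exec.Read_Nil exec.Read_Cons in force)+
  next
    case (Seq c d)
    then obtain t u where "exec c s t (run c s)" "t \<le> cost c"
      "exec d (run c s) u (run d (run c s))" "u \<le> cost d" by (meson loop_free.simps(1))
    then show ?case by (auto intro!: exI[of _ "t + u"] exec.Seq)
  next
    case (Cond r c d)
    then obtain t u where "exec c s t (run c s)" "t \<le> cost c" "exec d s u (run d s)" "u \<le> cost d"
      by (meson loop_free.simps(2))
    with exec.Cond_True[of s r c t "run c s" d] exec.Cond_False[of s r d u "run d s" c]
    show ?case
      by (cases "reg s r = 0")
         (auto intro!: exI[of _ "Suc (if reg s r = 0 then u else t)"])
  qed (auto intro: exec.Skip exec.SetC exec.Move exec.LoadM exec.StoreM exec.Add exec.Sub exec.Write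
         intro!: exI[of _ "1::nat"])
  with assms show ?thesis unfolding runs_def by (meson le_trans)
qed

text \<open>The remaining budget is a difference, so a given bound can be spent from the left
  without guessing how it splits.\<close>

lemma runs_Seq_loop_free:
  "loop_free c \<Longrightarrow> cost c \<le> T \<Longrightarrow> runs d (run c s) (T - cost c) P \<Longrightarrow> runs (Seq c d) s T P"
  using runs_Seq[of c s "cost c" "\<lambda>s'. s' = run c s" d "T - cost c" P]
    runs_loop_free[of c "\<lambda>s'. s' = run c s"]
  by simp

lemma computes_within_mono: "computes_within c xs ys T \<Longrightarrow> T \<le> T' \<Longrightarrow> computes_within c xs ys T'"
  unfolding computes_within_def using le_trans by blast


lemma computes_withinI:
  "runs c (initial_state xs) T (\<lambda>s. out s = ys) \<Longrightarrow> computes_within c xs ys T"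
  by (auto simp: runs_def computes_within_def)

fun seqs :: "com list \<Rightarrow> com" where
  "seqs [] = Skip"
| "seqs [c] = c"
| "seqs (c # cs) = Seq c (seqs cs)"


section \<open>The program for the choice functions\<close>

text \<open>Memory: cell \<open>w < 2 * n + 2\<close> flags that agent \<open>w\<close> belongs to the argument, and cell
  \<open>2 * n + 2 + i * n + j\<close> holds the join of positions \<open>i\<close> and \<open>j\<close>.
  Registers: 2 holds \<open>n\<close>, 3 holds 1, 4 the agent, 7 holds \<open>2 * n\<close>, 5 a loop counter, 9 and 10 the
  preferred and the other firm (for a worker) or the offsets of inputs and outputs (for a firm),
  13 the current position and 12 the address of its row. The row address is advanced by addition,
  as the machine cannot multiply.\<close>

definition load_flags :: com where
  "load_flags = While 5 (seqs [Read 6, StoreM 6 3, Sub 5 5 3])"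

text \<open>Truncated subtraction serves as comparison: \<open>n - a\<close> is nonzero iff the
  worker \<open>a\<close> belongs to the first block.\<close>

definition choose_worker :: com where
  "choose_worker = seqs
     [Sub 8 2 4,
      Cond 8 (seqs [Move 9 7, Add 10 7 3]) (seqs [Add 9 7 3, Move 10 7]),
      LoadM 11 9,
      Cond 11 (Write 9) (seqs [LoadM 11 10, Cond 11 (Write 10) Skip])]"

definition for_rows :: "com \<Rightarrow> com" where
  "for_rows c = Seq (seqs [Move 5 2, SetC 13 0, Add 12 7 3, Add 12 12 3])
     (While 5 (Seq c (seqs [Add 13 13 3, Add 12 12 2, Sub 5 5 3])))"

text \<open>With the address of row \<open>k\<close> in register 12 and the accumulator
  \<open>m\<close> in register 14, this fetches \<open>J k m\<close>.\<close>

definition join_row :: com where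
  "join_row = seqs [Add 15 12 14, LoadM 15 15]"

text \<open>The three loops of a firm share the accumulator in register 14. A position \<open>i\<close> lies below the
  accumulator \<open>m\<close> iff \<open>J i m = m\<close>, so each step reads only the entry \<open>J i m\<close>. Once the bottom has
  become the accumulator of the first loop, no later position replaces it.\<close>

definition bottom_body :: com where
  "bottom_body = seqs
     [join_row, Sub 16 15 14, Sub 17 14 15, Add 16 16 17, Cond 16 Skip (Move 14 13)]"

definition join_body :: com where
  "join_body = seqs
     [join_row, Add 16 9 13, LoadM 16 16, Cond 16 (Move 14 15) Skip]"

definition output_body :: com where
  "output_body = seqs
     [join_row, Sub 16 15 14, Sub 17 14 15, Add 16 16 17,
      Add 17 9 13, LoadM 18 17, Cond 18 (Write 17) Skip,
      Add 17 10 13, LoadM 18 17, Cond 18 (Cond 16 (Write 17) Skip) Skip]"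

text \<open>The search for the bottom starts at position 0. The join then starts at the bottom, so
  an empty set of inputs needs no special case.\<close>

definition choose_firm :: com where
  "choose_firm = Seq (seqs
     [Sub 8 4 7,
      Cond 8 (seqs [SetC 9 0, Move 10 2]) (seqs [Move 9 2, SetC 10 0]),
      SetC 14 0])
     (seqs [for_rows bottom_body, for_rows join_body, for_rows output_body])"

text \<open>Mentions neither \<open>n\<close> nor the table: its code is one fixed word, which the
  market builder can write out verbatim.\<close>

definition choice_main :: com where
  "choice_main = Seq (seqs [SetC 3 1, Read 4, Read 5]) (Seq load_flags
     (Seq (seqs [Add 7 2 2, Sub 8 7 4]) (Cond 8 choose_worker choose_firm)))"

fun store_table :: "nat \<Rightarrow> nat list \<Rightarrow> com \<Rightarrow> com" where
  "store_table b [] c = c"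
| "store_table b (d # ds) c =
     Seq (SetC 0 b) (Seq (SetC 1 d) (Seq (StoreM 0 1) (store_table (Suc b) ds c)))"

definition choice_program :: "nat \<Rightarrow> nat list \<Rightarrow> com" where
  "choice_program n D = store_table (2 * n + 2) D (Seq (SetC 2 n) choice_main)"

text \<open>\<open>K\<close> collects what no body changes, so \<open>Inv\<close> speaks only of the
  rows done, the accumulator and the output. A row costs 20 for the body, 3 for the updates and 1
  for the test; the initialisation and the last test make 5.\<close>

lemma runs_for_rows:
  fixes K :: "state \<Rightarrow> bool" and n i j :: nat and M :: "nat \<Rightarrow> nat"
  defines "K \<equiv> \<lambda>s. reg s 2 = n \<and> reg s 3 = 1 \<and> reg s 7 = 2 * n \<and> reg s 9 = i \<and> reg s 10 = j
    \<and> mem s = M"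
  assumes "loop_free c" "cost c \<le> 20"
    and body: "\<And>k s. k < n \<Longrightarrow> K s \<Longrightarrow> reg s 13 = k \<Longrightarrow> reg s 12 = 2 * n + 2 + k * n \<Longrightarrow>
      Inv k (reg s 14) (out s) \<Longrightarrow>
      K (run c s) \<and> reg (run c s) 13 = k \<and> reg (run c s) 12 = reg s 12 \<and>
      reg (run c s) 5 = reg s 5 \<and> Inv (Suc k) (reg (run c s) 14) (out (run c s))"
    and "K s" "Inv 0 (reg s 14) (out s)"
  shows "runs (for_rows c) s (n * 24 + 5) (\<lambda>s. K s \<and> Inv n (reg s 14) (out s))"
proof -
  \<comment> \<open>Here \<open>k\<close> counts the remaining rows, as \<open>runs_While\<close>
    counts down, whereas \<open>Inv\<close> counts the rows done.\<close>
  define J where "J k s \<longleftrightarrow> k \<le> n \<and> K s \<and> reg s 13 = n - k \<and> reg s 5 = k \<and>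
    reg s 12 = 2 * n + 2 + (n - k) * n \<and> Inv (n - k) (reg s 14) (out s)" for k s
  let ?init = "seqs [Move 5 2, SetC 13 0, Add 12 7 3, Add 12 12 3]"
  let ?b = "Seq c (seqs [Add 13 13 3, Add 12 12 2, Sub 5 5 3])"
  have 1: "runs (While 5 ?b) s (n * Suc 23 + 1) (J 0)" if "J n s" for s
  proof (rule runs_While[where Inv = J, OF _ _ that])
    fix k s assume s: "J (Suc k) s"
    then have k: "n - k = Suc (n - Suc k)" by (auto simp: J_def)
    have "runs ?b s 23 (J k)"
    proof (rule runs_loop_free)
      show "J k (run ?b s)"
        using body[of "n - Suc k" s] s unfolding J_def k by (auto simp: K_def)
    qed (use assms in auto)
    with s show "reg s 5 \<noteq> 0 \<and> runs ?b s 23 (J k)" by (simp add: J_def)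
  qed (simp add: J_def)
  have "runs (for_rows c) s (n * Suc 23 + 5) (J 0)"
    unfolding for_rows_def
    by (intro runs_Seq_loop_free runs_mono[OF 1, of _ _ "J 0"])
       (use assms(5,6) in \<open>auto simp: J_def K_def\<close>)
  then show ?thesis
    by (rule runs_mono) (auto simp: J_def)
qed

text \<open>A branch-free equality test: one of the two truncated differences is always
  zero.\<close>

lemma diff_add_diff_eq_0_iff: "x - y + (y - x) = 0 \<longleftrightarrow> x = y" for x y :: nat
  by auto

text \<open>Hides the scratch registers behind an unknown register file, so that the loop proofs
  need not unfold the code.\<close>

lemma run_bottom_body:
  "\<exists>r. run bottom_body s = s\<lparr>reg := r\<rparr> \<and> (\<forall>x\<in>{2, 3, 5, 7, 9, 10, 12, 13}. r x = reg s x) \<and>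
    r 14 = (if mem s (reg s 12 + reg s 14) = reg s 14 then reg s 13 else reg s 14)"
  by (rule exI[of _ "reg (run bottom_body s)"])
     (simp add: bottom_body_def join_row_def diff_add_diff_eq_0_iff del: add_is_0)

lemma run_join_body:
  "\<exists>r. run join_body s = s\<lparr>reg := r\<rparr> \<and> (\<forall>x\<in>{2, 3, 5, 7, 9, 10, 12, 13}. r x = reg s x) \<and>
    r 14 = (if mem s (reg s 9 + reg s 13) = 0 then reg s 14 else mem s (reg s 12 + reg s 14))"
  by (rule exI[of _ "reg (run join_body s)"])
     (simp add: join_body_def join_row_def)

lemma run_output_body:
  "\<exists>r. run output_body s = s\<lparr>reg := r, out := out s
      @ (if mem s (reg s 9 + reg s 13) = 0 then [] else [reg s 9 + reg s 13])
      @ (if mem s (reg s 10 + reg s 13) = 0 \<or> mem s (reg s 12 + reg s 14) = reg s 14 then []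
         else [reg s 10 + reg s 13])\<rparr> \<and>
    (\<forall>x\<in>{2, 3, 5, 7, 9, 10, 12, 13, 14}. r x = reg s x)"
  by (rule exI[of _ "reg (run output_body s)"])
     (simp add: output_body_def join_row_def diff_add_diff_eq_0_iff del: add_is_0)

text \<open>A lattice on the positions \<open>{..<n}\<close>: \<open>J\<close> is the join table and \<open>b\<close> the bottom.\<close>

locale indexed_lattice =
  fixes n :: nat and le :: "nat \<Rightarrow> nat \<Rightarrow> bool" and J :: "nat \<Rightarrow> nat \<Rightarrow> nat" and b :: nat
  assumes refl: "i < n \<Longrightarrow> le i i"
    and trans: "i < n \<Longrightarrow> j < n \<Longrightarrow> k < n \<Longrightarrow> le i j \<Longrightarrow> le j k \<Longrightarrow> le i k"
    and antisym: "i < n \<Longrightarrow> j < n \<Longrightarrow> le i j \<Longrightarrow> le j i \<Longrightarrow> i = j"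
    and J_less: "i < n \<Longrightarrow> j < n \<Longrightarrow> J i j < n"
    and J_le: "i < n \<Longrightarrow> j < n \<Longrightarrow> k < n \<Longrightarrow> le (J i j) k \<longleftrightarrow> le i k \<and> le j k"
    and b_less: "b < n"
    and b_le: "i < n \<Longrightarrow> le b i"
begin

text \<open>\<open>cl S\<close> is the down-set of the join of \<open>S\<close>, phrased so that \<open>S = {}\<close> needs no special case.\<close>

definition cl :: "nat set \<Rightarrow> nat set" where
  "cl S = {i. i < n \<and> (\<forall>k<n. (\<forall>s\<in>S. s < n \<longrightarrow> le s k) \<longrightarrow> le i k)}"

lemma J_eq_iff: "i < n \<Longrightarrow> j < n \<Longrightarrow> J i j = j \<longleftrightarrow> le i j"
  using J_le J_less refl antisym by metis

text \<open>The second assumption says that \<open>m\<close> is the join of \<open>S\<close>. It is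
  then the least upper bound \<open>k\<close> in \<open>cl\<close>, and transitivity covers all
  others.\<close>

lemma cl_eq_down:
  assumes "m < n" "\<And>c. c < n \<Longrightarrow> le m c \<longleftrightarrow> (\<forall>s\<in>S. s < n \<longrightarrow> le s c)"
  shows "cl S = {i. i < n \<and> le i m}"
  using assms trans refl unfolding cl_def by blast

lemma runs_choose_firm:
  fixes M :: "nat \<Rightarrow> nat"
  assumes table: "\<And>k l. k < n \<Longrightarrow> l < n \<Longrightarrow> M (2 * n + 2 + k * n + l) = J k l"
    and flag: "\<And>w. w < 2 * n + 2 \<Longrightarrow> M w = (if w \<in> T then 1 else 0)"
    and T: "T \<subseteq> {..<2 * n}"
    and s: "reg s 2 = n" "reg s 3 = 1" "reg s 4 = a" "reg s 7 = 2 * n" "mem s = M" "out s = []"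
    and ij: "a = 2 * n \<and> i = n \<and> j = 0 \<or> a = 2 * n + 1 \<and> i = 0 \<and> j = n"
  shows "runs choose_firm s (n * 72 + 25) (\<lambda>s. enumerates (out s) (firm_choice n cl i j T))"
proof -
  define K where "K s \<longleftrightarrow> reg s 2 = n \<and> reg s 3 = 1 \<and> reg s 7 = 2 * n \<and> reg s 9 = i \<and>
    reg s 10 = j \<and> mem s = M" for s :: state
  have ij': "i = n \<and> j = 0 \<or> i = 0 \<and> j = n" using ij by auto
  have flag': "M (i + k) = (if i + k \<in> T then 1 else 0)" "M (j + k) = (if j + k \<in> T then 1 else 0)"
    if "k < n" for k
  proof -
    have "i + k < 2 * n + 2" "j + k < 2 * n + 2" using that ij' by linarith+
    then show "M (i + k) = (if i + k \<in> T then 1 else 0)" "M (j + k) = (if j + k \<in> T then 1 else 0)"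
      by (simp_all only: flag)
  qed
  note rows = runs_for_rows[where n = n and i = i and j = j and M = M, folded K_def]
  have loop1: "runs (for_rows bottom_body) s (n * 24 + 5) (\<lambda>s. K s \<and> reg s 14 = b \<and> out s = [])"
    if "K s" "reg s 14 = 0" "out s = []" for s
  \<comment> \<open>Row \<open>b\<close> always replaces the accumulator by \<open>b\<close>, and
    only \<open>b\<close> itself lies below \<open>b\<close> afterwards.\<close>
  proof (rule runs_mono[OF rows[where Inv = "\<lambda>k m os. m < n \<and> os = [] \<and> (b < k \<longrightarrow> m = b)"]])
    fix k s
    assume "k < n" "K s" "reg s 13 = k" "reg s 12 = 2 * n + 2 + k * n"
      "reg s 14 < n \<and> out s = [] \<and> (b < k \<longrightarrow> reg s 14 = b)"
    moreover from this have "mem s (reg s 12 + reg s 14) = reg s 14 \<longleftrightarrow> le k (reg s 14)"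
      using table[of k "reg s 14"] J_eq_iff[of k "reg s 14"] by (simp add: K_def)
    moreover have "le k b \<longleftrightarrow> k = b" "le b (reg s 14)"
      using \<open>k < n\<close> calculation b_le b_less antisym refl by blast+
    moreover obtain r where "run bottom_body s = s\<lparr>reg := r\<rparr>"
      "\<forall>x\<in>{2, 3, 5, 7, 9, 10, 12, 13}. r x = reg s x"
      "r 14 = (if mem s (reg s 12 + reg s 14) = reg s 14 then reg s 13 else reg s 14)"
      using run_bottom_body by blast
    ultimately show "K (run bottom_body s) \<and> reg (run bottom_body s) 13 = k \<and>
      reg (run bottom_body s) 12 = reg s 12 \<and> reg (run bottom_body s) 5 = reg s 5 \<and>
      reg (run bottom_body s) 14 < n \<and> out (run bottom_body s) = [] \<and>
      (b < Suc k \<longrightarrow> reg (run bottom_body s) 14 = b)"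
      by (auto simp: K_def less_Suc_eq)
  qed (use b_less that in \<open>auto simp: bottom_body_def join_row_def\<close>)
  \<comment> \<open>The join of the inputs seen so far, expressed by its upper bounds; for
    \<open>k = 0\<close> it is the bottom.\<close>
  define lub where "lub k m \<longleftrightarrow> m < n \<and> (\<forall>c<n. le m c \<longleftrightarrow> (\<forall>s<k. i + s \<in> T \<longrightarrow> le s c))" for k m
  have loop2: "runs (for_rows join_body) s (n * 24 + 5) (\<lambda>s. K s \<and> lub n (reg s 14) \<and> out s = [])"
    if "K s" "reg s 14 = b" "out s = []" for s
  proof (rule runs_mono[OF rows[where Inv = "\<lambda>k m os. lub k m \<and> os = []"]])
    fix k s
    assume "k < n" "K s" "reg s 13 = k" "reg s 12 = 2 * n + 2 + k * n"
      "lub k (reg s 14) \<and> out s = []"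
    moreover from this have "mem s (reg s 12 + reg s 14) = J k (reg s 14)"
      using table[of k "reg s 14"] by (simp add: K_def lub_def)
    moreover from calculation have "mem s (reg s 9 + reg s 13) = (if i + k \<in> T then 1 else 0)"
      using flag'(1)[of k] by (simp add: K_def)
    moreover obtain r where "run join_body s = s\<lparr>reg := r\<rparr>"
      "\<forall>x\<in>{2, 3, 5, 7, 9, 10, 12, 13}. r x = reg s x"
      "r 14 = (if mem s (reg s 9 + reg s 13) = 0 then reg s 14 else mem s (reg s 12 + reg s 14))"
      using run_join_body by blast
    ultimately show "K (run join_body s) \<and> reg (run join_body s) 13 = k \<and>
      reg (run join_body s) 12 = reg s 12 \<and> reg (run join_body s) 5 = reg s 5 \<and>
      lub (Suc k) (reg (run join_body s) 14) \<and> out (run join_body s) = []"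
      using J_le[of k "reg s 14"] J_less[of k "reg s 14"]
      by (auto simp: K_def less_Suc_eq lub_def)
  qed (use b_less b_le that in \<open>auto simp: join_body_def join_row_def lub_def\<close>)
  have loop3: "runs (for_rows output_body) s (n * 24 + 5)
      (\<lambda>s. enumerates (out s) (firm_choice n cl i j T))"
    if "K s" "lub n (reg s 14)" "out s = []" for s
  proof -
    define m where "m = reg s 14"
    then have m: "m < n" using that by (simp add: lub_def)
    have cl: "cl (slice n i T) = {i. i < n \<and> le i m}"
      by (rule cl_eq_down) (use that in \<open>auto simp: m_def lub_def slice_def\<close>)
    \<comment> \<open>What must have been written after \<open>k\<close> rounds; round
      \<open>k\<close> handles the workers \<open>i + k\<close> and \<open>j + k\<close>.\<close>
    define part where "part k = firm_choice n cl i j T \<inter> (\<Union>l<k. {i + l, j + l})" for k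
    have part_Suc: "part (Suc k) = part k \<union> ({i + k} \<inter> T) \<union> (if le k m then {} else {j + k} \<inter> T)"
      and fresh: "i + k \<notin> part k" "j + k \<notin> part k" "i + k \<noteq> j + k" if "k < n" for k
      using that ij' by (auto simp: part_def lessThan_Suc firm_choice_def cl)
    have part_n: "part n = firm_choice n cl i j T"
    proof -
      have "w \<in> (\<Union>l<n. {i + l, j + l})" if "w < 2 * n" for w
      proof (cases "w < n")
        case True then show ?thesis using ij' by auto
      next
        case False
        then have "\<exists>l<n. w = n + l" using that by (intro exI[of _ "w - n"]) auto
        then show ?thesis using ij' by auto
      qed
      then have "firm_choice n cl i j T \<subseteq> (\<Union>l<n. {i + l, j + l})"
        using T unfolding firm_choice_def by blast
      then show ?thesis unfolding part_def by blast
    qed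
    show ?thesis
    proof (rule runs_mono[OF rows[where Inv = "\<lambda>k l os. l = m \<and> distinct os \<and> set os = part k"]])
      fix k s
      assume k: "k < n" and K: "K s" and r13: "reg s 13 = k" and r12: "reg s 12 = 2 * n + 2 + k * n"
        and o: "reg s 14 = m \<and> distinct (out s) \<and> set (out s) = part k"
      have "mem s (reg s 12 + reg s 14) = reg s 14 \<longleftrightarrow> le k m"
        using k K r12 o m table[of k m] J_eq_iff[of k m] by (simp add: K_def)
      moreover have "mem s (reg s 9 + reg s 13) = (if i + k \<in> T then 1 else 0)"
        "mem s (reg s 10 + reg s 13) = (if j + k \<in> T then 1 else 0)"
        "reg s 9 + reg s 13 = i + k" "reg s 10 + reg s 13 = j + k"
        using k K r13 flag'[of k] by (simp_all add: K_def)
      ultimately obtain r where run: "run output_body s = s\<lparr>reg := r, out := out s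
          @ (if i + k \<in> T then [i + k] else []) @ (if j + k \<in> T \<and> \<not> le k m then [j + k] else [])\<rparr>"
        and r: "\<forall>x\<in>{2, 3, 5, 7, 9, 10, 12, 13, 14}. r x = reg s x"
        using run_output_body[of s] by (auto split: if_splits)
      have "distinct (out (run output_body s)) \<and> set (out (run output_body s)) = part (Suc k)"
        using o fresh[OF k] unfolding run part_Suc[OF k] by auto
      then show "K (run output_body s) \<and> reg (run output_body s) 13 = k \<and>
        reg (run output_body s) 12 = reg s 12 \<and> reg (run output_body s) 5 = reg s 5 \<and>
        reg (run output_body s) 14 = m \<and> distinct (out (run output_body s)) \<and>
        set (out (run output_body s)) = part (Suc k)"
        using r K r13 o unfolding run by (simp add: K_def)
    qed (use that part_n in \<open>auto simp: output_body_def join_row_def enumerates_def m_def part_def\<close>)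
  qed
  show ?thesis
    unfolding choose_firm_def
    apply (rule runs_Seq_loop_free)
      apply simp apply simp
    apply (simp only: seqs.simps)
    apply (rule runs_mono[OF runs_Seq[OF loop1 runs_Seq[OF loop2 loop3]]])
    using s ij by (auto simp: K_def)
qed
end

section \<open>Storing the table, reading the flags, choosing for a worker\<close>

lemma runs_store_table:
  assumes "\<And>s'. inp s' = inp s \<Longrightarrow> out s' = out s \<Longrightarrow>
    mem s' = (\<lambda>x. if b \<le> x \<and> x < b + length D then D ! (x - b) else mem s x) \<Longrightarrow> runs c s' T P"
  shows "runs (store_table b D c) s (3 * length D + T) P"
  using assms
proof (induction D arbitrary: b s)
  case Nil
  show ?case using Nil.prems[of s] by (simp add: fun_eq_iff)
next
  case (Cons d D)
  let ?s = "run (StoreM 0 1) (run (SetC 1 d) (run (SetC 0 b) s))"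
  have "runs (store_table (Suc b) D c) ?s (3 * length D + T) P"
  proof (rule Cons.IH)
    fix s' :: state assume s': "inp s' = inp ?s" "out s' = out ?s"
      "mem s' = (\<lambda>x. if Suc b \<le> x \<and> x < Suc b + length D then D ! (x - Suc b) else mem ?s x)"
    show "runs c s' T P"
    proof (rule Cons.prems)
      show "mem s' = (\<lambda>x. if b \<le> x \<and> x < b + length (d # D) then (d # D) ! (x - b) else mem s x)"
        unfolding s'(3) by (auto simp: fun_eq_iff nth_Cons' Suc_le_eq)
    qed (use s' in auto)
  qed
  then show ?case
    by (auto intro!: runs_Seq_loop_free)
qed

lemma runs_load_flags:
  assumes "reg s 5 = length (inp s)" "reg s 3 = 1" "out s = []" "reg s 2 = n" "reg s 4 = a"
  shows "runs load_flags s (length (inp s) * 4 + 1) (\<lambda>s'. reg s' 3 = 1 \<and> out s' = [] \<and>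
    reg s' 2 = n \<and> reg s' 4 = a \<and> mem s' = (\<lambda>x. if x \<in> set (inp s) then 1 else mem s x))"
proof -
  \<comment> \<open>\<open>us\<close> is the part of the argument that has been read.\<close>
  define Inv where "Inv k s' \<longleftrightarrow> k = length (inp s') \<and> reg s' 5 = k \<and> reg s' 3 = 1 \<and> out s' = [] \<and>
    reg s' 2 = n \<and> reg s' 4 = a \<and> (\<exists>us. us @ inp s' = inp s \<and>
      mem s' = (\<lambda>x. if x \<in> set us then 1 else mem s x))" for k and s' :: state
  have "runs load_flags s (length (inp s) * Suc 3 + 1) (Inv 0)"
    unfolding load_flags_def
  proof (rule runs_While)
    fix k s' assume s': "Inv (Suc k) s'"
    then obtain u vs us where inp: "inp s' = u # vs" "us @ u # vs = inp s"
      "mem s' = (\<lambda>x. if x \<in> set us then 1 else mem s x)"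
      by (cases "inp s'") (auto simp: Inv_def)
    have "runs (seqs [Read 6, StoreM 6 3, Sub 5 5 3]) s' 3 (Inv k)"
    proof (rule runs_loop_free)
      show "Inv k (run (seqs [Read 6, StoreM 6 3, Sub 5 5 3]) s')"
        using s' inp by (auto simp: Inv_def fun_eq_iff intro!: exI[of _ "us @ [u]"])
    qed auto
    moreover have "reg s' 5 = Suc k" using s' unfolding Inv_def by blast
    ultimately show "reg s' 5 \<noteq> 0 \<and> runs (seqs [Read 6, StoreM 6 3, Sub 5 5 3]) s' 3 (Inv k)"
      by simp
  qed (use assms in \<open>auto simp: Inv_def\<close>)
  then show ?thesis by (rule runs_mono) (auto simp: Inv_def)
qed

lemma runs_choose_worker:
  fixes s :: state
  assumes flag: "\<And>w. w < 2 * n + 2 \<Longrightarrow> mem s w = (if w \<in> T then 1 else 0)"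
    and s: "reg s 2 = n" "reg s 3 = 1" "reg s 4 = a" "reg s 7 = 2 * n" "out s = []"
    and xy: "a < n \<and> x = 2 * n \<and> y = 2 * n + 1 \<or> n \<le> a \<and> x = 2 * n + 1 \<and> y = 2 * n"
  shows "runs choose_worker s 12 (\<lambda>s. enumerates (out s) (worker_choice x y T))"
proof (rule runs_loop_free)
  have "mem s x = (if x \<in> T then 1 else 0)" "mem s y = (if y \<in> T then 1 else 0)"
    using xy by (auto simp: flag)
  then show "enumerates (out (run choose_worker s)) (worker_choice x y T)"
    using s xy by (cases "x \<in> T"; cases "y \<in> T")
      (auto simp: choose_worker_def enumerates_def worker_choice_def)
qed (auto simp: choose_worker_def)

section \<open>The closure operator of joins and correctness of its program\<close>

context indexed_lattice
begin

lemma cl_subset: "cl S \<subseteq> {..<n}"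
  by (auto simp: cl_def)

lemma subset_cl: "S \<subseteq> {..<n} \<Longrightarrow> S \<subseteq> cl S"
  by (auto simp: cl_def)

lemma cl_mono: "S \<subseteq> T \<Longrightarrow> cl S \<subseteq> cl T"
  by (auto simp: cl_def subset_iff)

lemma cl_idem: "cl (cl S) = cl S"
  using subset_cl[OF cl_subset] by (auto simp: cl_def)

sublocale closure_op n cl
  using cl_subset cl_mono cl_idem by unfold_locales

lemma cl_down: "i < n \<Longrightarrow> cl {j. j < n \<and> le j i} = {j. j < n \<and> le j i}"
  by (rule subset_antisym, auto simp: cl_def)

text \<open>Starting from the bottom, adding elements one by one with \<open>J\<close> yields a join
  of \<open>S\<close>; a fixed point is the down-set of its join.\<close>

lemma cl_fixed_imp_down:
  assumes "cl S = S" "S \<subseteq> {..<n}"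
  obtains m where "m < n" "S = {j. j < n \<and> le j m}"
proof -
  have "\<exists>m<n. \<forall>c<n. le m c \<longleftrightarrow> (\<forall>s\<in>S. le s c)"
    using finite_subset[OF assms(2) finite_lessThan] assms(2)
  proof (induction S rule: finite_induct)
    case empty
    then show ?case using b_less b_le by auto
  next
    case (insert s S)
    then obtain m where "m < n" "\<forall>c<n. le m c \<longleftrightarrow> (\<forall>s\<in>S. le s c)" by auto
    with insert.prems show ?case
      by (intro exI[of _ "J s m"]) (auto simp: J_le J_less)
  qed
  then obtain m where "m < n" "\<forall>c<n. le m c \<longleftrightarrow> (\<forall>s\<in>S. le s c)" by blast
  then have "cl S = {j. j < n \<and> le j m}"
    using assms(2) by (intro cl_eq_down) auto
  with \<open>m < n\<close> assms(1) that show thesis by simp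
qed

text \<open>Storing the table takes 3 steps per entry, reading the flags 4 steps for each of at most
  \<open>2 * n\<close> agents, and the three loops of a firm \<open>72 * n\<close>, up to
  constants.\<close>

lemma choice_program_correct:
  assumes D: "length D = n * n" "\<And>i j. i < n \<Longrightarrow> j < n \<Longrightarrow> D ! (i * n + j) = J i j"
    and a: "a \<in> agents I" and T: "T \<subseteq> opposite I a" and ts: "enumerates ts T"
  shows "\<exists>ys. enumerates ys (choice I a T) \<and>
    computes_within (choice_program n D) (a # length ts # ts) ys (3 * (n * n) + 80 * n + 50)"
proof -
  have a: "a < 2 * n + 2" using a by (auto simp: agents_eq)
  have T': "T \<subseteq> {..<2 * n + 2}"
    using T by (auto simp: opposite_def closure_market_def split: if_splits)
  \<comment> \<open>A worker may be offered both firms, and \<open>2 \<le> 2 * n\<close> needs a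
    nonempty lattice.\<close>
  have "n > 0" using b_less by auto
  have "card T \<le> 2 * n"
  proof (cases "a < 2 * n")
    case True
    then have "T \<subseteq> {2 * n, 2 * n + 1}" using T by (auto simp: opposite_def closure_market_def)
    then have "card T \<le> card {2 * n, 2 * n + 1}" by (intro card_mono) auto
    then show ?thesis using \<open>n > 0\<close> by simp
  next
    case False
    then have "T \<subseteq> {..<2 * n}" using T a by (auto simp: opposite_def closure_market_def split: if_splits)
    then have "card T \<le> card {..<2 * n}" by (intro card_mono) auto
    then show ?thesis by simp
  qed
  then have len: "length ts \<le> 2 * n" using ts by (auto simp: enumerates_def distinct_card)
  let ?E = "\<lambda>s. enumerates (out s) (choice I a T)"
  have tail: "runs (Seq (seqs [Add 7 2 2, Sub 8 7 4]) (Cond 8 choose_worker choose_firm)) s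
      (2 + Suc (n * 72 + 25)) ?E"
    if s: "reg s 3 = 1" "out s = []" "reg s 2 = n" "reg s 4 = a"
      "mem s = (\<lambda>x. if x \<in> set ts then 1 else if 2 * n + 2 \<le> x \<and> x < 2 * n + 2 + length D
         then D ! (x - (2 * n + 2)) else 0)" for s
  proof -
    define s' where "s' = run (seqs [Add 7 2 2, Sub 8 7 4]) s"
    have s': "reg s' 3 = 1" "out s' = []" "reg s' 2 = n" "reg s' 4 = a" "reg s' 7 = 2 * n"
      "reg s' 8 = 2 * n - a" and mem: "mem s' = mem s"
      using s by (auto simp: s'_def)
    have flag: "mem s' w = (if w \<in> T then 1 else 0)" if "w < 2 * n + 2" for w
      using that ts by (auto simp: mem s(5) enumerates_def)
    have table: "mem s' (2 * n + 2 + k * n + l) = J k l" if kl: "k < n" "l < n" for k l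
    proof -
      have "k * n + l < n * n"
      proof -
        have "k * n + l < Suc k * n" using kl by simp
        also have "\<dots> \<le> n * n" using kl by (intro mult_right_mono) auto
        finally show ?thesis .
      qed
      \<comment> \<open>Flags occupy cells below \<open>2 * n + 2\<close>, so reading the argument
        does not overwrite the table.\<close>
      moreover have "2 * n + 2 + k * n + l \<notin> set ts"
        using ts T' by (auto simp: enumerates_def)
      ultimately show ?thesis using D kl by (simp add: mem s(5) add.assoc)
    qed
    have "runs (Cond 8 choose_worker choose_firm) s' (Suc (n * 72 + 25)) ?E"
    proof (rule runs_Cond)
      assume "reg s' 8 \<noteq> 0"
      then have "a < 2 * n" using s' by simp
      then obtain x y where xy: "a < n \<and> x = 2 * n \<and> y = 2 * n + 1 \<or> n \<le> a \<and> x = 2 * n + 1 \<and> y = 2 * n"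
        "choice I a = worker_choice x y"
        by (cases "a < n") (auto simp: closure_market_def)
      show "runs choose_worker s' (n * 72 + 25) ?E"
        unfolding xy(2)
        by (rule runs_mono[OF runs_choose_worker[OF flag s'(3,1,4,5,2) xy(1)]]) auto
    next
      assume "reg s' 8 = 0"
      then have a': "a = 2 * n \<or> a = 2 * n + 1" using s' a by auto
      then obtain i j where ij: "a = 2 * n \<and> i = n \<and> j = 0 \<or> a = 2 * n + 1 \<and> i = 0 \<and> j = n"
        "choice I a = firm_choice n cl i j"
        by (auto simp: closure_market_def)
      have T2: "T \<subseteq> {..<2 * n}" using T a' by (auto simp: opposite_def closure_market_def)
      show "runs choose_firm s' (n * 72 + 25) ?E"
        unfolding ij(2) by (rule runs_choose_firm[OF table flag T2 s'(3,1,4,5) HOL.refl s'(2) ij(1)])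
    qed
    then show ?thesis
      unfolding s'_def by - (rule runs_Seq_loop_free, simp_all)
  qed
  have main: "runs (Seq (SetC 2 n) choice_main) s (1 + (3 + ((length ts * 4 + 1) + (2 + Suc (n * 72 + 25))))) ?E"
    if s: "inp s = a # length ts # ts" "out s = []"
      "mem s = (\<lambda>x. if 2 * n + 2 \<le> x \<and> x < 2 * n + 2 + length D then D ! (x - (2 * n + 2)) else 0)" for s
  proof -
    define s' where "s' = run (seqs [SetC 3 1, Read 4, Read 5]) (run (SetC 2 n) s)"
    have s': "reg s' 3 = 1" "reg s' 5 = length (inp s')" "reg s' 2 = n" "reg s' 4 = a"
      "out s' = []" "mem s' = mem s" "inp s' = ts"
      using s by (auto simp: s'_def)
    have "runs (Seq load_flags (Seq (seqs [Add 7 2 2, Sub 8 7 4]) (Cond 8 choose_worker choose_firm)))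
      s' ((length ts * 4 + 1) + (2 + Suc (n * 72 + 25))) ?E"
      by (rule runs_Seq[OF runs_load_flags[OF s'(2,1,5,3,4), unfolded s'(7)] tail])
         (simp_all add: s' s(3) cong: if_cong)
    then show ?thesis
      unfolding choice_main_def s'_def
      by - (rule runs_Seq_loop_free, simp, simp, rule runs_Seq_loop_free, simp_all)
  qed
  have "runs (choice_program n D) (initial_state (a # length ts # ts))
     (3 * (n * n) + 80 * n + 50) ?E"
    unfolding choice_program_def
    by (rule runs_mono[OF runs_store_table[OF main]])
       (use len in \<open>auto simp: initial_state_def D(1) fun_eq_iff\<close>)
  then show ?thesis
    by (auto simp: runs_def computes_within_def)
qed

section \<open>Principal down-sets as stable matchings\<close>

definition down_matching :: "nat \<Rightarrow> (nat \<times> nat) set" where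
  "down_matching i = closure_matching n {j. j < n \<and> le j i}"

lemma le_down_matching:
  assumes "i < n" "j < n"
  shows "down_matching i \<sqsubseteq>\<^bsub>stable_lattice I\<^esub> down_matching j \<longleftrightarrow> le i j"
proof -
  have "{k. k < n \<and> le k i} \<subseteq> {k. k < n \<and> le k j} \<longleftrightarrow> le i j"
    using assms refl trans by blast
  then show ?thesis
    unfolding down_matching_def using assms
    by (subst le_closure_matching) (auto simp: cl_down)
qed

lemma bij_betw_down_matching: "bij_betw down_matching {..<n} (carrier (stable_lattice I))"
  unfolding bij_betw_def
proof
  show "inj_on down_matching {..<n}"
  proof (rule inj_onI)
    fix i j assume ij: "i \<in> {..<n}" "j \<in> {..<n}" and eq: "down_matching i = down_matching j"
    have "le i i" "le j j" using ij refl by auto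
    \<comment> \<open>The matchings coincide, so reflexivity at \<open>i\<close> and at
      \<open>j\<close> can be read as the two comparisons.\<close>
    then have "le i j" "le j i"
      using le_down_matching[of i i] le_down_matching[of i j] le_down_matching[of j j]
        le_down_matching[of j i] ij eq by auto
    with ij show "i = j" using antisym by auto
  qed
  show "down_matching ` {..<n} = carrier (stable_lattice I)"
  proof
    show "down_matching ` {..<n} \<subseteq> carrier (stable_lattice I)"
      unfolding stable_lattice_def down_matching_def
      by (auto intro!: stable_closure_matching simp: cl_down)
    show "carrier (stable_lattice I) \<subseteq> down_matching ` {..<n}"
    proof
      fix \<mu> assume "\<mu> \<in> carrier (stable_lattice I)"
      then obtain S where S: "S \<subseteq> {..<n}" "cl S = S" "\<mu> = closure_matching n S"
        by (auto simp: stable_lattice_def elim: stable_imp_closure_matching)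
      then obtain m where "m < n" "S = {j. j < n \<and> le j m}" using cl_fixed_imp_down by metis
      with S show "\<mu> \<in> down_matching ` {..<n}" by (auto simp: down_matching_def)
    qed
  qed
qed

end


section \<open>The program for the market\<close>

text \<open>Register 9 is scratch here, so the builder keeps nothing in it.\<close>

definition emit :: "nat list \<Rightarrow> com" where
  "emit ks = foldr (\<lambda>k c. Seq (SetC 9 k) (Seq (Write 9) c)) ks Skip"

lemma loop_free_emit [simp]: "loop_free (emit ks)"
  by (induction ks) (auto simp: emit_def)

lemma cost_emit [simp]: "cost (emit ks) = 2 * length ks + 1"
  by (induction ks) (auto simp: emit_def)

lemma run_emit:
  "inp (run (emit ks) s) = inp s" "out (run (emit ks) s) = out s @ ks"
  "r \<noteq> 9 \<Longrightarrow> reg (run (emit ks) s) r = reg s r"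
  by (induction ks arbitrary: s) (auto simp: emit_def)

text \<open>The encoding of \<open>store_table b D c\<close> up to \<open>c\<close>: since \<open>Seq\<close> is nested to the right there, it can be
  written out while the join table is read, without knowing what follows.\<close>

fun table_code :: "nat \<Rightarrow> nat list \<Rightarrow> nat list" where
  "table_code b [] = []"
| "table_code b (d # ds) = [9, 1, 0, b, 9, 1, 1, d, 9, 4, 0, 1] @ table_code (Suc b) ds"

lemma encode_store_table: "encode_com (store_table b D c) = table_code b D @ encode_com c"
  by (induction D arbitrary: b) auto

text \<open>Writes one block of \<open>table_code\<close>; 9, 1 and 4 are the codes of
  \<open>Seq\<close>, \<open>SetC\<close> and \<open>StoreM\<close>. Register 7 holds the address, 8
  the entry, 6 the number of entries left.\<close>

definition copy_entry :: com where
  "copy_entry = seqs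
     [Read 8, emit [9, 1, 0], Write 7, emit [9, 1, 1], Write 8, emit [9, 4, 0, 1],
      Add 7 7 1, Sub 6 6 1]"

text \<open>The first four outputs are the number of firms, the two firms and the number of workers.
  The number \<open>n * n\<close> of table entries comes from repeated addition.\<close>

definition build_market :: com where
  "build_market =
     Seq (seqs [Read 0, SetC 1 1, Add 2 0 0, Add 3 2 1, SetC 4 2,
        Write 4, Write 2, Write 3, Write 2, Move 5 2, SetC 6 0])
     (Seq (While 5 (seqs [Write 6, Add 6 6 1, Sub 5 5 1]))
     (Seq (seqs [Move 5 0, SetC 6 0])
     (Seq (While 5 (seqs [Add 6 6 0, Sub 5 5 1]))
     (Seq (Add 7 3 1)
     (Seq (While 6 copy_entry)
     (seqs [emit [9, 1, 2], Write 0, emit (encode_com choice_main)]))))))"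

lemma runs_copy_table:
  assumes "reg s 0 = n" "reg s 1 = 1" "reg s 7 = b" "reg s 6 = length D" "inp s = D @ rest"
  shows "runs (While 6 copy_entry) s (length D * 29 + 1)
    (\<lambda>s'. reg s' 0 = n \<and> out s' = out s @ table_code b D)"
proof -
  \<comment> \<open>The output so far followed by the code of the entries still to be read is
    constant.\<close>
  define Inv where "Inv k s' \<longleftrightarrow> reg s' 0 = n \<and> reg s' 1 = 1 \<and> reg s' 6 = k \<and> k \<le> length (inp s') \<and>
    out s' @ table_code (reg s' 7) (take k (inp s')) = out s @ table_code b D" for k and s' :: state
  have "runs (While 6 copy_entry) s (length D * Suc 28 + 1) (Inv 0)"
  proof (rule runs_While)
    fix k s' assume s': "Inv (Suc k) s'"
    then obtain u vs where inp: "inp s' = u # vs"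
      by (cases "inp s'") (auto simp: Inv_def)
    have "runs copy_entry s' 28 (Inv k)"
    proof (rule runs_loop_free)
      show "Inv k (run copy_entry s')"
        using s' inp by (simp add: Inv_def copy_entry_def run_emit)
    qed (auto simp: copy_entry_def)
    moreover have "reg s' 6 \<noteq> 0" using s' by (simp add: Inv_def)
    ultimately show "reg s' 6 \<noteq> 0 \<and> runs copy_entry s' 28 (Inv k)" by blast
  qed (use assms in \<open>auto simp: Inv_def\<close>)
  then show ?thesis by (rule runs_mono) (auto simp: Inv_def)
qed

lemma runs_write_upto:
  assumes "reg s 5 = m" "reg s 6 = 0" "reg s 1 = 1" "reg s 0 = n" "reg s 3 = b" "inp s = D"
  shows "runs (While 5 (seqs [Write 6, Add 6 6 1, Sub 5 5 1])) s (m * 4 + 1)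
    (\<lambda>s'. reg s' 0 = n \<and> reg s' 1 = 1 \<and> reg s' 3 = b \<and> inp s' = D \<and> out s' = out s @ [0..<m])"
proof -
  define Inv where "Inv k s' \<longleftrightarrow> reg s' 0 = n \<and> reg s' 1 = 1 \<and> reg s' 3 = b \<and> inp s' = D \<and>
    reg s' 5 = k \<and> reg s' 6 + k = m \<and> out s' = out s @ [0..<reg s' 6]" for k and s' :: state
  have "runs (While 5 (seqs [Write 6, Add 6 6 1, Sub 5 5 1])) s (m * Suc 3 + 1) (Inv 0)"
  proof (rule runs_While)
    fix k s' assume s': "Inv (Suc k) s'"
    have "runs (seqs [Write 6, Add 6 6 1, Sub 5 5 1]) s' 3 (Inv k)"
      by (rule runs_loop_free) (use s' in \<open>auto simp: Inv_def\<close>)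
    moreover have "reg s' 5 \<noteq> 0" using s' by (simp add: Inv_def)
    ultimately show "reg s' 5 \<noteq> 0 \<and> runs (seqs [Write 6, Add 6 6 1, Sub 5 5 1]) s' 3 (Inv k)"
      by blast
  qed (use assms in \<open>auto simp: Inv_def\<close>)
  then show ?thesis by (rule runs_mono) (auto simp: Inv_def)
qed

lemma runs_square:
  assumes "reg s 5 = n" "reg s 6 = 0" "reg s 1 = 1" "reg s 0 = n" "reg s 3 = b" "inp s = D" "out s = os"
  shows "runs (While 5 (seqs [Add 6 6 0, Sub 5 5 1])) s (n * 3 + 1)
    (\<lambda>s'. reg s' 0 = n \<and> reg s' 1 = 1 \<and> reg s' 3 = b \<and> reg s' 6 = n * n \<and> inp s' = D \<and> out s' = os)"
proof -
  define Inv where "Inv k s' \<longleftrightarrow> reg s' 0 = n \<and> reg s' 1 = 1 \<and> reg s' 3 = b \<and> inp s' = D \<and>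
    reg s' 5 = k \<and> reg s' 6 + k * n = n * n \<and> out s' = os" for k and s' :: state
  have "runs (While 5 (seqs [Add 6 6 0, Sub 5 5 1])) s (n * Suc 2 + 1) (Inv 0)"
  proof (rule runs_While)
    fix k s' assume s': "Inv (Suc k) s'"
    have "runs (seqs [Add 6 6 0, Sub 5 5 1]) s' 2 (Inv k)"
      by (rule runs_loop_free) (use s' in \<open>auto simp: Inv_def\<close>)
    moreover have "reg s' 5 \<noteq> 0" using s' by (simp add: Inv_def)
    ultimately show "reg s' 5 \<noteq> 0 \<and> runs (seqs [Add 6 6 0, Sub 5 5 1]) s' 2 (Inv k)" by blast
  qed (use assms in \<open>auto simp: Inv_def\<close>)
  then show ?thesis by (rule runs_mono) (auto simp: Inv_def)
qed

text \<open>The stages are verified from the last to the first, each together with all that follows.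
  Only copying the table is quadratic; \<open>rest\<close> will be the meet table.\<close>

lemma build_market_correct:
  assumes "length D = n * n"
  shows "computes_within build_market (n # D @ rest)
    (encode_market [2 * n, 2 * n + 1] [0..<2 * n] (choice_program n D))
    (29 * (n * n) + 11 * n + (2 * length (encode_com choice_main) + 26))"
proof -
  let ?h = "2 # [2 * n, 2 * n + 1] @ [2 * n]"
  let ?P = "\<lambda>s. out s = encode_market [2 * n, 2 * n + 1] [0..<2 * n] (choice_program n D)"
  have market: "encode_market [2 * n, 2 * n + 1] [0..<2 * n] (choice_program n D) =
    ?h @ [0..<2 * n] @ table_code (2 * n + 2) D @ [9, 1, 2, n] @ encode_com choice_main"
    by (simp add: encode_market_def choice_program_def encode_store_table)
  have last: "runs (seqs [emit [9, 1, 2], Write 0, emit (encode_com choice_main)]) s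
      (2 * length (encode_com choice_main) + 9) ?P"
    if "reg s 0 = n" "out s = (?h @ [0..<2 * n]) @ table_code (2 * n + 2) D" for s
    unfolding market by (rule runs_loop_free) (use that in \<open>auto simp: run_emit\<close>)
  have table: "runs (Seq (Add 7 3 1) (Seq (While 6 copy_entry)
      (seqs [emit [9, 1, 2], Write 0, emit (encode_com choice_main)]))) s
      (1 + ((length D * 29 + 1) + (2 * length (encode_com choice_main) + 9))) ?P"
    if s: "reg s 0 = n" "reg s 1 = 1" "reg s 3 = 2 * n + 1" "reg s 6 = n * n" "inp s = D @ rest"
      "out s = ?h @ [0..<2 * n]" for s
  proof -
    let ?s = "run (Add 7 3 1) s"
    have "runs (Seq (While 6 copy_entry) (seqs [emit [9, 1, 2], Write 0, emit (encode_com choice_main)])) ?s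
      ((length D * 29 + 1) + (2 * length (encode_com choice_main) + 9)) ?P"
      by (rule runs_Seq[OF runs_copy_table[where n = n and b = "2 * n + 2" and rest = rest] last])
         (use s assms in auto)
    then show ?thesis by - (rule runs_Seq_loop_free, simp_all)
  qed
  have square: "runs (Seq (seqs [Move 5 0, SetC 6 0]) (Seq (While 5 (seqs [Add 6 6 0, Sub 5 5 1]))
      (Seq (Add 7 3 1) (Seq (While 6 copy_entry)
      (seqs [emit [9, 1, 2], Write 0, emit (encode_com choice_main)]))))) s
      (2 + ((n * 3 + 1) + (1 + ((length D * 29 + 1) + (2 * length (encode_com choice_main) + 9))))) ?P"
    if s: "reg s 0 = n" "reg s 1 = 1" "reg s 3 = 2 * n + 1" "inp s = D @ rest"
      "out s = ?h @ [0..<2 * n]" for s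
  proof -
    let ?s = "run (seqs [Move 5 0, SetC 6 0]) s"
    have "runs (Seq (While 5 (seqs [Add 6 6 0, Sub 5 5 1]))
      (Seq (Add 7 3 1) (Seq (While 6 copy_entry)
      (seqs [emit [9, 1, 2], Write 0, emit (encode_com choice_main)])))) ?s
      ((n * 3 + 1) + (1 + ((length D * 29 + 1) + (2 * length (encode_com choice_main) + 9)))) ?P"
      by (rule runs_Seq[OF runs_square[where n = n and b = "2 * n + 1"] table])
         (use s in auto)
    then show ?thesis by - (rule runs_Seq_loop_free, simp_all)
  qed
  define s where "s = run (seqs [Read 0, SetC 1 1, Add 2 0 0, Add 3 2 1, SetC 4 2,
        Write 4, Write 2, Write 3, Write 2, Move 5 2, SetC 6 0]) (initial_state (n # D @ rest))"
  have s: "reg s 5 = 2 * n" "reg s 6 = 0" "reg s 1 = 1" "reg s 0 = n" "reg s 3 = 2 * n + 1"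
     "inp s = D @ rest" "out s = ?h"
    by (simp_all add: s_def initial_state_def)
  have "runs build_market (initial_state (n # D @ rest))
    (11 + ((2 * n * 4 + 1) + (2 + ((n * 3 + 1) + (1 + ((length D * 29 + 1) +
      (2 * length (encode_com choice_main) + 9))))))) ?P"
    unfolding build_market_def
  proof (rule runs_Seq_loop_free)
    have "runs (Seq (While 5 (seqs [Write 6, Add 6 6 1, Sub 5 5 1]))
     (Seq (seqs [Move 5 0, SetC 6 0])
     (Seq (While 5 (seqs [Add 6 6 0, Sub 5 5 1]))
     (Seq (Add 7 3 1)
     (Seq (While 6 copy_entry)
     (seqs [emit [9, 1, 2], Write 0, emit (encode_com choice_main)]))))))
      s ((2 * n * 4 + 1) + (2 + ((n * 3 + 1) + (1 + ((length D * 29 + 1) +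
      (2 * length (encode_com choice_main) + 9)))))) ?P"
      by (rule runs_Seq[OF runs_write_upto[OF s(1-6)] square]) (use s in auto)
    then show "runs (Seq (While 5 (seqs [Write 6, Add 6 6 1, Sub 5 5 1]))
     (Seq (seqs [Move 5 0, SetC 6 0])
     (Seq (While 5 (seqs [Add 6 6 0, Sub 5 5 1]))
     (Seq (Add 7 3 1)
     (Seq (While 6 copy_entry)
     (seqs [emit [9, 1, 2], Write 0, emit (encode_com choice_main)]))))))
      (run (seqs [Read 0, SetC 1 1, Add 2 0 0, Add 3 2 1, SetC 4 2,
        Write 4, Write 2, Write 3, Write 2, Move 5 2, SetC 6 0]) (initial_state (n # D @ rest)))
     (11 + ((2 * n * 4 + 1) + (2 + ((n * 3 + 1) + (1 + ((length D * 29 + 1) +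
      (2 * length (encode_com choice_main) + 9)))))) -
      cost (seqs [Read 0, SetC 1 1, Add 2 0 0, Add 3 2 1, SetC 4 2,
        Write 4, Write 2, Write 3, Write 2, Move 5 2, SetC 6 0])) ?P"
      unfolding s_def by simp
  qed auto
  then show ?thesis
    using assms by (intro computes_withinI) (auto elim!: runs_mono)
qed

section \<open>Size of the encoded market\<close>

lemma bit_size_append: "bit_size (xs @ ys) = bit_size xs + bit_size ys"
  by (simp add: bit_size_def)

lemma floor_log_le_self: "floor_log k \<le> k"
proof (cases "k = 0")
  case False
  then have "2 ^ floor_log k \<le> k" by (intro floor_log_exp2_le) auto
  then show ?thesis using less_exp[of "floor_log k"] by linarith
qed simp

lemma bit_size_le: "(\<And>k. k \<in> set xs \<Longrightarrow> k \<le> m) \<Longrightarrow> bit_size xs \<le> length xs * Suc m"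
proof (induction xs)
  case (Cons k xs)
  then have "bit_size xs \<le> length xs * Suc m" "floor_log k \<le> m"
    using floor_log_le_self[of k] by force+
  then show ?case by (simp add: bit_size_def)
qed (simp add: bit_size_def)

lemma length_table_code: "length (table_code b D) = 12 * length D"
  by (induction D arbitrary: b) auto

lemma set_table_code:
  "k \<in> set (table_code b D) \<Longrightarrow> k \<le> 9 \<or> k < b + length D \<or> k \<in> set D"
  by (induction D arbitrary: b) fastforce+

text \<open>Apart from the fixed code of \<open>choice_main\<close> there are quadratically many
  numbers of quadratic size. Bounding a logarithm crudely by its argument still gives degree
  4.\<close>

lemma bit_size_encode_market_le:
  assumes "length D = n * n" "\<And>d. d \<in> set D \<Longrightarrow> d < n"
  shows "bit_size (encode_market [2 * n, 2 * n + 1] [0..<2 * n] (choice_program n D)) \<le>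
    (200 + bit_size (encode_com choice_main)) * (2 * n + 2) ^ 4"
proof -
  let ?N = "2 * n + 2" and ?K = "bit_size (encode_com choice_main)"
  let ?w = "(2 # [2 * n, 2 * n + 1] @ [2 * n]) @ [0..<2 * n] @ table_code (2 * n + 2) D @ [9, 1, 2, n]"
  have "bit_size ?w \<le> length ?w * Suc (n * n + 2 * n + 11)"
  proof (rule bit_size_le)
    fix k assume "k \<in> set ?w"
    then consider "k \<le> 2 * n + 9" | "k \<in> set (table_code (2 * n + 2) D)" by force
    then show "k \<le> n * n + 2 * n + 11"
    proof cases
      case 2
      then show ?thesis using assms set_table_code[OF 2] by fastforce
    qed auto
  qed
  also have "length ?w = 12 * (n * n) + 2 * n + 8"
    by (simp add: length_table_code assms(1))
  also have "\<dots> * Suc (n * n + 2 * n + 11) \<le> (4 * ?N ^ 2) * (3 * ?N ^ 2)"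
    by (intro mult_le_mono) (simp_all add: power2_eq_square algebra_simps)
  also have "\<dots> = 12 * ?N ^ 4"
    by (simp add: power_add[symmetric] flip: power2_eq_square)
  finally have "bit_size ?w \<le> 12 * ?N ^ 4" .
  moreover have "?K \<le> ?K * ?N ^ 4" by simp
  moreover have "encode_market [2 * n, 2 * n + 1] [0..<2 * n] (choice_program n D) =
    ?w @ encode_com choice_main"
    by (simp add: encode_market_def choice_program_def encode_store_table)
  then have "bit_size (encode_market [2 * n, 2 * n + 1] [0..<2 * n] (choice_program n D)) =
    bit_size ?w + ?K"
    by (metis bit_size_append)
  ultimately show ?thesis unfolding add_mult_distrib by linarith
qed

lemma length_concat_map_map: "length (concat (map (\<lambda>x. map (f x) ys) xs)) = length xs * length ys"
  by (induction xs) auto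

lemma nth_concat_map_map:
  "i < length xs \<Longrightarrow> j < length ys \<Longrightarrow>
    concat (map (\<lambda>x. map (f x) ys) xs) ! (i * length ys + j) = f (xs ! i) (ys ! j)"
proof (induction xs arbitrary: i)
  case (Cons x xs)
  then show ?case by (cases i) (auto simp: nth_append)
qed simp


section \<open>Realising a lattice\<close>

lemma indexed_latticeI:
  fixes L (structure)
  assumes L: "lattice L" "finite (carrier L)" "carrier L \<noteq> {}" and xs: "enumerates xs (carrier L)"
  defines "n \<equiv> length xs" and "pos \<equiv> inv_into {..<length xs} ((!) xs)"
  shows "\<exists>b. indexed_lattice n (\<lambda>i j. xs ! i \<sqsubseteq> xs ! j) (\<lambda>i j. pos (xs ! i \<squnion> xs ! j)) b"
proof -
  interpret lattice L by fact
  have mem: "xs ! i \<in> carrier L" if "i < n" for i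
    using xs that by (auto simp: enumerates_def n_def)
  have pos: "pos x < n" "xs ! pos x = x" if "x \<in> carrier L" for x
  proof -
    have "bij_betw ((!) xs) {..<length xs} (carrier L)"
      using xs by (auto simp: enumerates_def bij_betw_nth)
    then have "x \<in> (!) xs ` {..<length xs}" using that by (simp add: bij_betw_imp_surj_on)
    then show "pos x < n" "xs ! pos x = x"
      unfolding pos_def n_def
      by (metis inv_into_into lessThan_iff, metis f_inv_into_f)
  qed
  \<comment> \<open>The meet of all elements is the bottom; it exists because the carrier is finite
    and nonempty.\<close>
  define bt where "bt = \<Sqinter>carrier L"
  have "greatest L bt (Lower L (carrier L))"
    unfolding bt_def using finite_inf_greatest[of "carrier L"] L by simp
  then have bt: "bt \<in> carrier L" "\<And>x. x \<in> carrier L \<Longrightarrow> bt \<sqsubseteq> x"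
    by (auto intro: greatest_closed greatest_Lower_below)
  have "indexed_lattice n (\<lambda>i j. xs ! i \<sqsubseteq> xs ! j) (\<lambda>i j. pos (xs ! i \<squnion> xs ! j)) (pos bt)"
  proof
    fix i j assume "i < n" "j < n" "xs ! i \<sqsubseteq> xs ! j" "xs ! j \<sqsubseteq> xs ! i"
    then have "xs ! i = xs ! j" using mem le_antisym by blast
    with \<open>i < n\<close> \<open>j < n\<close> xs show "i = j"
      by (simp add: enumerates_def n_def nth_eq_iff_index_eq)
  next
    fix i j k assume ijk: "i < n" "j < n" "k < n"
    show "xs ! pos (xs ! i \<squnion> xs ! j) \<sqsubseteq> xs ! k \<longleftrightarrow> xs ! i \<sqsubseteq> xs ! k \<and> xs ! j \<sqsubseteq> xs ! k"
      using mem[OF ijk(1)] mem[OF ijk(2)] mem[OF ijk(3)]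
      by (auto simp: pos(2) intro: join_le le_trans[OF join_left] le_trans[OF join_right])
  next
    fix i j k assume "i < n" "j < n" "k < n" "xs ! i \<sqsubseteq> xs ! j" "xs ! j \<sqsubseteq> xs ! k"
    then show "xs ! i \<sqsubseteq> xs ! k" using le_trans[of "xs ! i" "xs ! j" "xs ! k"] mem by simp
  qed (auto simp: mem pos bt)
  then show ?thesis ..
qed

text \<open>An element goes to its position, and the position to the matching of its
  down-set.\<close>

lemma order_isomorphic_stable_lattice:
  fixes L (structure)
  assumes L: "lattice L" and xs: "enumerates xs (carrier L)"
    and "indexed_lattice (length xs) (\<lambda>i j. xs ! i \<sqsubseteq> xs ! j) J b"
  defines "leq \<equiv> \<lambda>i j. xs ! i \<sqsubseteq> xs ! j"
  shows "order_isomorphic L (stable_lattice (closure_market (length xs) (indexed_lattice.cl (length xs) leq)))"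
proof -
  interpret indexed_lattice "length xs" leq J b using assms by simp
  define pos where "pos = inv_into {..<length xs} ((!) xs)"
  have nth: "bij_betw ((!) xs) {..<length xs} (carrier L)"
    using xs by (auto simp: enumerates_def bij_betw_nth)
  then have pos: "bij_betw pos (carrier L) {..<length xs}"
    unfolding pos_def by (rule bij_betw_inv_into)
  have nth_pos: "xs ! pos x = x" "pos x < length xs" if "x \<in> carrier L" for x
    using that bij_betw_inv_into_right[OF nth] bij_betwE[OF pos] unfolding pos_def by auto
  show ?thesis
    unfolding order_isomorphic_def
  proof (intro exI conjI ballI)
    show "bij_betw (down_matching \<circ> pos) (carrier L) (carrier (stable_lattice I))"
      by (rule bij_betw_trans[OF pos bij_betw_down_matching])
    fix x y assume "x \<in> carrier L" "y \<in> carrier L"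
    then have "pos x < length xs" "pos y < length xs" "leq (pos x) (pos y) \<longleftrightarrow> x \<sqsubseteq> y"
      by (simp_all add: nth_pos leq_def)
    then show "x \<sqsubseteq> y \<longleftrightarrow> (down_matching \<circ> pos) x \<sqsubseteq>\<^bsub>stable_lattice I\<^esub> (down_matching \<circ> pos) y"
      by (simp only: le_down_matching comp_apply)
  qed
qed

theorem theorem1:
  shows "\<exists>(A :: com) (c :: nat) (p :: nat poly).
    \<forall>(L :: 'a gorder) xs.
      lattice L \<longrightarrow> finite (carrier L) \<longrightarrow> carrier L \<noteq> {} \<longrightarrow> enumerates xs (carrier L) \<longrightarrow>
      (\<exists>I Fs Ws Q.
        standard_market p I Fs Ws Q \<and>
        order_isomorphic L (stable_lattice I) \<and>
        card (agents I) \<le> c * card (carrier L) ^ 4 \<and>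
        computes_within A (encode_lattice L xs) (encode_market Fs Ws Q)
          (c * card (carrier L) ^ 6))"
\<comment> \<open>The outer witnesses stay schematic until the last \<open>show\<close>; introduced
  before \<open>L\<close> and \<open>xs\<close>, they cannot depend on the lattice.\<close>
proof (intro exI allI impI)
  let ?K = "length (encode_com choice_main)"
  fix L :: "'a gorder" and xs
  assume L: "lattice L" "finite (carrier L)" "carrier L \<noteq> {}" and xs: "enumerates xs (carrier L)"
  define n where "n = length xs"
  define pos where "pos = inv_into {..<length xs} ((!) xs)"
  define leq where "leq i j \<longleftrightarrow> xs ! i \<sqsubseteq>\<^bsub>L\<^esub> xs ! j" for i j
  define J where "J i j = pos (xs ! i \<squnion>\<^bsub>L\<^esub> xs ! j)" for i j
  obtain b where b: "indexed_lattice n leq J b"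
    using indexed_latticeI[OF L xs] unfolding n_def leq_def J_def pos_def by blast
  interpret indexed_lattice n leq J b by fact
  have card: "card (carrier L) = n"
    using xs distinct_card[of xs] by (auto simp: enumerates_def n_def)
  have "n \<ge> 1" using b_less by simp
  define D where "D = [pos (x \<squnion>\<^bsub>L\<^esub> y). x \<leftarrow> xs, y \<leftarrow> xs]"
  have D: "length D = n * n" "\<And>i j. i < n \<Longrightarrow> j < n \<Longrightarrow> D ! (i * n + j) = J i j"
    unfolding D_def n_def J_def by (simp_all add: length_concat_map_map nth_concat_map_map)
  have D_less: "d < n" if "d \<in> set D" for d
  proof -
    from that obtain i j where "i < n" "j < n" "d = J i j"
      unfolding D_def n_def J_def by (auto simp: in_set_conv_nth)
    then show ?thesis using J_less by simp
  qed
  let ?Fs = "[2 * n, 2 * n + 1]" and ?Ws = "[0..<2 * n]" and ?Q = "choice_program n D"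
  \<comment> \<open>Degree 4 comes from the bit size; the summand 200 also covers the quadratic
    running time of the choice program.\<close>
  let ?p = "monom (200 + bit_size (encode_com choice_main)) 4 :: nat poly"
  have size: "card (firms I) + card (workers I) = 2 * n + 2"
    by (simp add: market_simps)
  have time: "3 * (n * n) + 80 * n + 50 \<le> poly ?p (2 * n + 2)"
  proof -
    have "3 * (n * n) + 80 * n + 50 \<le> 200 * (2 * n + 2) ^ 2"
      by (simp add: power2_eq_square algebra_simps)
    also have "\<dots> \<le> 200 * (2 * n + 2) ^ 4" by (intro mult_le_mono power_increasing) auto
    also have "\<dots> \<le> poly ?p (2 * n + 2)" by (simp add: poly_monom)
    finally show ?thesis .
  qed
  have "standard_market ?p I ?Fs ?Ws ?Q"
    unfolding standard_market_def size
  proof (intro conjI ballI allI impI matching_market path_independent)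
    show "enumerates ?Fs (firms I)" "enumerates ?Ws (workers I)"
      by (auto simp: enumerates_def market_simps)
    show "bit_size (encode_market ?Fs ?Ws ?Q) \<le> poly ?p (2 * n + 2)"
      using bit_size_encode_market_le[OF D(1) D_less] by (simp add: poly_monom)
    fix a T ts
    assume "a \<in> agents I" "T \<subseteq> opposite I a" "enumerates ts T"
    from choice_program_correct[OF D this]
    show "\<exists>ys. enumerates ys (choice I a T) \<and>
        computes_within ?Q (a # length ts # ts) ys (poly ?p (2 * n + 2))"
      using computes_within_mono[OF _ time] by blast
  qed
  moreover have "order_isomorphic L (stable_lattice I)"
    using order_isomorphic_stable_lattice[OF L(1) xs, of J b] b
    unfolding n_def leq_def by simp
  moreover have "card (agents I) \<le> (100 + 2 * ?K) * card (carrier L) ^ 4"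
  proof -
    have "card (agents I) \<le> 4 * n ^ 1" using \<open>n \<ge> 1\<close> by (simp add: agents_eq)
    also have "\<dots> \<le> (100 + 2 * ?K) * n ^ 4"
      using \<open>n \<ge> 1\<close> by (intro mult_le_mono power_increasing) auto
    finally show ?thesis by (simp add: card)
  qed
  moreover have "computes_within build_market (encode_lattice L xs) (encode_market ?Fs ?Ws ?Q)
    ((100 + 2 * ?K) * card (carrier L) ^ 6)"
  proof -
    \<comment> \<open>The time is quadratic in \<open>n\<close>; as \<open>n\<close> is positive,
      lower powers and the constant are absorbed into \<open>n ^ 6\<close>.\<close>
    have "n * n \<le> n ^ 6" "n \<le> n ^ 6" "1 \<le> n ^ 6"
      using \<open>n \<ge> 1\<close> power_increasing[of 2 6 n] power_increasing[of 1 6 n]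
      by (auto simp: power2_eq_square)
    moreover have "2 * ?K * 1 \<le> 2 * ?K * n ^ 6" using calculation(3) by (intro mult_le_mono) auto
    ultimately have "29 * (n * n) + 11 * n + (2 * ?K + 26) \<le> (100 + 2 * ?K) * n ^ 6"
      unfolding add_mult_distrib by linarith
    moreover have "encode_lattice L xs = n # D @ [pos (x \<sqinter>\<^bsub>L\<^esub> y). x \<leftarrow> xs, y \<leftarrow> xs]"
      by (simp add: encode_lattice_def n_def D_def pos_def Let_def)
    ultimately show ?thesis
      using computes_within_mono[OF build_market_correct[OF D(1)]] card by simp
  qed
  ultimately show "standard_market ?p I ?Fs ?Ws ?Q \<and> order_isomorphic L (stable_lattice I) \<and>
      card (agents I) \<le> (100 + 2 * ?K) * card (carrier L) ^ 4 \<and>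
      computes_within build_market (encode_lattice L xs) (encode_market ?Fs ?Ws ?Q)
        ((100 + 2 * ?K) * card (carrier L) ^ 6)"
    by blast
qed

end
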